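(* Let $M$ be a pseudo-umbilical submanifold of a locally product Riemannian manifold $(\overline{M},g)$ with product structure $F$, and let $H$ be the mean curvature vector field of $M$. Then the identity $$g\big((\nabla_{\phi X}C)H,CH\big)=-g\big(h(\phi X,BH),CH\big)$$ is satisfied for all $X\in\Gamma(TM)$ if and only if one of the following is satisfied: (1) $M$ is a minimal submanifold; (2) $M$ is a semi-invariant submanifold; (3) $\omega\phi X$ is perpendicular to $CH$ for all $X\in\Gamma(TM)$. Here $(\nabla_{\phi X}C)H=\nabla_{\phi X}^{\bot}CH-C(\nabla_{\phi X}^{\bot}H)$.
   Context: Locally product Riemannian manifold: a Riemannian manifold $(\overline{M},g)$ with Levi-Civita connection $\overline{\nabla}$, equipped with a $(1,1)$-tensor field $F$ (the product structure) such that $F^2=I$, $F\neq\pm I$, $g(FX,FY)=g(X,Y)$ and $(\overline{\nabla}_XF)Y=0$ for all $X,Y\in\Gamma(T\overline{M})$. Let $M$ be an isometrically immersed Riemannian submanifold of $\overline{M}$, with tangent bundle $TM$, normal bundle $TM^{\bot}$ and Levi-Civita connection $\nabla$. For $X,Y\in\Gamma(TM)$ and $\xi\in\Gamma(TM^{\bot})$, the Gauss and Weingarten formulas $\overline{\nabla}_XY=\nabla_XY+h(X,Y)$ and $\overline{\nabla}_X\xi=-A_\xi X+\nabla_X^{\bot}\xi$ (decompositions into tangent and normal parts) define the second fundamental form $h$, the shape operator $A_\xi$ and the normal connection $\nabla^{\bot}$; one has $g(A_\xi X,Y)=g(h(X,Y),\xi)$. The mean curvature vector field is $H=\frac1n\sum_{i=1}^n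 h(e_i,e_i)$, where $n=\dim M$ and $\{e_i\}$ is a local orthonormal frame of $TM$. $M$ is minimal if $H=0$. $M$ is pseudo-umbilical if $g(h(X,Y),H)=g(X,Y)g(H,H)$ for all $X,Y\in\Gamma(TM)$. For $X\in\Gamma(TM)$ write $FX=\phi X+\omega X$ with $\phi X$ tangent and $\omega X$ normal to $M$. For $\xi\in\Gamma(TM^{\bot})$ write $F\xi=B\xi+C\xi$ with $B\xi$ tangent and $C\xi$ normal to $M$. $M$ is a semi-invariant submanifold if there are two distributions $D,D^{\bot}$ on $M$ with $TM=D\oplus D^{\bot}$, $F(D)=D$ and $F(D^{\bot})\subset TM^{\bot}$ (either distribution is allowed to be zero). A known criterion: $M$ is semi-invariant if and only if $\omega\phi=0$ and $\phi$ has constant rank. *)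

theory Defs
  imports "HOL-Analysis.Analysis"
begin

section \<open>Smooth functions between Euclidean spaces\<close>

text \<open>\<open>Ck_on k S f\<close> is meant for open \<open>S\<close>: all iterated directional derivatives of \<open>f\<close>
  of order at most \<open>k\<close> exist (as Frechet derivatives) and are continuous on \<open>S\<close>.\<close>

primrec Ck_on ::
  "nat \<Rightarrow> 'a::euclidean_space set \<Rightarrow> ('a \<Rightarrow> 'b::real_normed_vector) \<Rightarrow> bool" where
  "Ck_on 0 S f \<longleftrightarrow> continuous_on S f"
| "Ck_on (Suc k) S f \<longleftrightarrow>
     f differentiable_on S \<and> (\<forall>v. Ck_on k S (\<lambda>x. frechet_derivative f (at x) v))"

definition smooth_on :: "'a::euclidean_space set \<Rightarrow> ('a \<Rightarrow> 'b::real_normed_vector) \<Rightarrow> bool" where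
  "smooth_on S f \<longleftrightarrow> (\<forall>k. Ck_on k S f)"


section \<open>Smooth manifolds\<close>

text \<open>A manifold is a Hausdorff, second countable type \<open>'m\<close> with a smooth atlas modelled on a
  Euclidean space \<open>'a\<close>; its dimension is \<open>DIM('a)\<close>. A chart is its domain together with its
  coordinate map.\<close>

type_synonym ('m, 'a) chart = "'m set \<times> ('m \<Rightarrow> 'a)"
type_synonym ('m, 'a) atlas = "('m, 'a) chart set"

abbreviation chart_dom :: "('m, 'a) chart \<Rightarrow> 'm set" where
  "chart_dom c \<equiv> fst c"

abbreviation chart_map :: "('m, 'a) chart \<Rightarrow> 'm \<Rightarrow> 'a" where
  "chart_map c \<equiv> snd c"

definition chart_inv :: "('m, 'a) chart \<Rightarrow> 'a \<Rightarrow> 'm" where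
  "chart_inv c = inv_into (chart_dom c) (chart_map c)"

definition is_chart :: "('m::topological_space, 'a::euclidean_space) chart \<Rightarrow> bool" where
  "is_chart c \<longleftrightarrow> open (chart_dom c) \<and> open (chart_map c ` chart_dom c) \<and>
     homeomorphism (chart_dom c) (chart_map c ` chart_dom c) (chart_map c) (chart_inv c)"

definition smooth_atlas ::
  "('m::{t2_space, second_countable_topology}, 'a::euclidean_space) atlas \<Rightarrow> bool" where
  "smooth_atlas A \<longleftrightarrow>
     (\<forall>c\<in>A. is_chart c) \<and>
     (\<Union>c\<in>A. chart_dom c) = UNIV \<and>
     (\<forall>c\<in>A. \<forall>d\<in>A. smooth_on (chart_map c ` (chart_dom c \<inter> chart_dom d))
                          (chart_map d \<circ> chart_inv c))"

text \<open>The tangent space at \<open>p\<close> is identified with the model space \<open>'a\<close> by means of a preferred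
  chart \<open>chart_at A p\<close>, chosen once and for all. Vector fields are therefore functions
  \<open>'m \<Rightarrow> 'a\<close>. As the preferred chart jumps with the point, smoothness is never read off
  such a function directly but off its components in the charts of the atlas.\<close>

definition chart_at :: "('m, 'a) atlas \<Rightarrow> 'm \<Rightarrow> ('m, 'a) chart" where
  "chart_at A p = (SOME c. c \<in> A \<and> p \<in> chart_dom c)"

definition smooth_fun_on ::
  "('m::topological_space, 'a::euclidean_space) atlas \<Rightarrow> 'm set
    \<Rightarrow> ('m \<Rightarrow> 'v::real_normed_vector) \<Rightarrow> bool" where
  "smooth_fun_on A U s \<longleftrightarrow> (\<forall>c\<in>A. smooth_on (chart_map c ` (chart_dom c \<inter> U)) (s \<circ> chart_inv c))"

text \<open>Directional derivative at \<open>p\<close>, along the tangent vector \<open>u\<close>, of a function with values in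
  a vector space.\<close>

definition dfun ::
  "('m, 'a::euclidean_space) atlas \<Rightarrow> ('m \<Rightarrow> 'v::real_normed_vector) \<Rightarrow> 'm \<Rightarrow> 'a \<Rightarrow> 'v" where
  "dfun A s p u =
     frechet_derivative (s \<circ> chart_inv (chart_at A p)) (at (chart_map (chart_at A p) p)) u"

text \<open>Components in the chart \<open>c\<close> of the tangent vector \<open>u\<close> at \<open>p\<close>, and the inverse operation.
  For fixed \<open>v\<close>, \<open>\<lambda>p. coord_vec A c p v\<close> is the vector field on the domain of \<open>c\<close> with constant
  components \<open>v\<close>; for \<open>v \<in> Basis\<close> it is a coordinate vector field.\<close>

definition vec_in ::
  "('m, 'a::euclidean_space) atlas \<Rightarrow> ('m, 'a) chart \<Rightarrow> 'm \<Rightarrow> 'a \<Rightarrow> 'a" where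
  "vec_in A c p u = dfun A (chart_map c) p u"

definition coord_vec ::
  "('m, 'a::euclidean_space) atlas \<Rightarrow> ('m, 'a) chart \<Rightarrow> 'm \<Rightarrow> 'a \<Rightarrow> 'a" where
  "coord_vec A c p v =
     frechet_derivative (chart_map (chart_at A p) \<circ> chart_inv c) (at (chart_map c p)) v"

definition smooth_vf_on ::
  "('m::topological_space, 'a::euclidean_space) atlas \<Rightarrow> 'm set \<Rightarrow> ('m \<Rightarrow> 'a) \<Rightarrow> bool" where
  "smooth_vf_on A U X \<longleftrightarrow>
     (\<forall>c\<in>A. smooth_on (chart_map c ` (chart_dom c \<inter> U))
              (\<lambda>x. vec_in A c (chart_inv c x) (X (chart_inv c x))))"

abbreviation vector_field ::
  "('m::topological_space, 'a::euclidean_space) atlas \<Rightarrow> ('m \<Rightarrow> 'a) \<Rightarrow> bool" where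
  "vector_field A X \<equiv> smooth_vf_on A UNIV X"

text \<open>At the point \<open>p\<close> itself the components of a vector in the chart \<open>chart_at A p\<close> are the
  vector, so this is the coordinate formula \<open>[X, Y] = X(Y\<^sup>i) - Y(X\<^sup>i)\<close>.\<close>

definition lie_bracket ::
  "('m, 'a::euclidean_space) atlas \<Rightarrow> ('m \<Rightarrow> 'a) \<Rightarrow> ('m \<Rightarrow> 'a) \<Rightarrow> 'm \<Rightarrow> 'a" where
  "lie_bracket A X Y p =
     dfun A (\<lambda>q. vec_in A (chart_at A p) q (Y q)) p (X p) -
     dfun A (\<lambda>q. vec_in A (chart_at A p) q (X q)) p (Y p)"


section \<open>Riemannian manifolds and the Levi-Civita connection\<close>

definition riemannian_metric ::
  "('m::topological_space, 'a::euclidean_space) atlas \<Rightarrow> ('m \<Rightarrow> 'a \<Rightarrow> 'a \<Rightarrow> real) \<Rightarrow> bool" where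
  "riemannian_metric A g \<longleftrightarrow>
     (\<forall>p. bilinear (g p)) \<and>
     (\<forall>p u v. g p u v = g p v u) \<and>
     (\<forall>p u. u \<noteq> 0 \<longrightarrow> g p u u > 0) \<and>
     (\<forall>c\<in>A. \<forall>v w. smooth_on (chart_map c ` chart_dom c)
        (\<lambda>x. g (chart_inv c x) (coord_vec A c (chart_inv c x) v) (coord_vec A c (chart_inv c x) w)))"

definition riemannian_manifold ::
  "('m::{t2_space, second_countable_topology}, 'a::euclidean_space) atlas
    \<Rightarrow> ('m \<Rightarrow> 'a \<Rightarrow> 'a \<Rightarrow> real) \<Rightarrow> bool" where
  "riemannian_manifold A g \<longleftrightarrow> smooth_atlas A \<and> riemannian_metric A g"

text \<open>A connection acts on locally defined vector fields: \<open>nab p u Y\<close> is the covariant derivative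
  at \<open>p\<close>, along \<open>u\<close>, of a field \<open>Y\<close> that is smooth near \<open>p\<close> (and arbitrary elsewhere). The
  Leibniz rule, applied to a function that is \<open>1\<close> near \<open>p\<close> and \<open>0\<close> elsewhere, shows that only the
  germ of \<open>Y\<close> at \<open>p\<close> matters.\<close>

type_synonym ('m, 'a) connection = "'m \<Rightarrow> 'a \<Rightarrow> ('m \<Rightarrow> 'a) \<Rightarrow> 'a"

definition affine_connection ::
  "('m::topological_space, 'a::euclidean_space) atlas \<Rightarrow> ('m, 'a) connection \<Rightarrow> bool" where
  "affine_connection A nab \<longleftrightarrow>
     (\<forall>U. open U \<longrightarrow>
        (\<forall>Y p. smooth_vf_on A U Y \<longrightarrow> p \<in> U \<longrightarrow> linear (\<lambda>u. nab p u Y)) \<and>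
        (\<forall>Y Z p u. smooth_vf_on A U Y \<longrightarrow> smooth_vf_on A U Z \<longrightarrow> p \<in> U \<longrightarrow>
           nab p u (\<lambda>q. Y q + Z q) = nab p u Y + nab p u Z) \<and>
        (\<forall>s Y p u. smooth_fun_on A U s \<longrightarrow> smooth_vf_on A U Y \<longrightarrow> p \<in> U \<longrightarrow>
           nab p u (\<lambda>q. s q *\<^sub>R Y q) = dfun A s p u *\<^sub>R Y p + s p *\<^sub>R nab p u Y) \<and>
        (\<forall>X Y. smooth_vf_on A U X \<longrightarrow> smooth_vf_on A U Y \<longrightarrow>
           smooth_vf_on A U (\<lambda>p. nab p (X p) Y)))"

definition levi_civita ::
  "('m::topological_space, 'a::euclidean_space) atlas \<Rightarrow> ('m \<Rightarrow> 'a \<Rightarrow> 'a \<Rightarrow> real)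
    \<Rightarrow> ('m, 'a) connection \<Rightarrow> bool" where
  "levi_civita A g nab \<longleftrightarrow> affine_connection A nab \<and>
     (\<forall>U. open U \<longrightarrow>
        (\<forall>X Y p. smooth_vf_on A U X \<longrightarrow> smooth_vf_on A U Y \<longrightarrow> p \<in> U \<longrightarrow>
           nab p (X p) Y - nab p (Y p) X = lie_bracket A X Y p) \<and>
        (\<forall>Y Z p u. smooth_vf_on A U Y \<longrightarrow> smooth_vf_on A U Z \<longrightarrow> p \<in> U \<longrightarrow>
           dfun A (\<lambda>q. g q (Y q) (Z q)) p u = g p (nab p u Y) (Z p) + g p (Y p) (nab p u Z)))"


section \<open>Locally product Riemannian manifolds\<close>

definition tensor11 ::
  "('m::topological_space, 'a::euclidean_space) atlas \<Rightarrow> ('m \<Rightarrow> 'a \<Rightarrow> 'a) \<Rightarrow> bool" where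
  "tensor11 A F \<longleftrightarrow> (\<forall>p. linear (F p)) \<and>
     (\<forall>c\<in>A. \<forall>v. smooth_on (chart_map c ` chart_dom c)
        (\<lambda>x. vec_in A c (chart_inv c x) (F (chart_inv c x) (coord_vec A c (chart_inv c x) v))))"

definition locally_product ::
  "('m::{t2_space, second_countable_topology}, 'a::euclidean_space) atlas
    \<Rightarrow> ('m \<Rightarrow> 'a \<Rightarrow> 'a \<Rightarrow> real) \<Rightarrow> ('m, 'a) connection \<Rightarrow> ('m \<Rightarrow> 'a \<Rightarrow> 'a) \<Rightarrow> bool" where
  "locally_product A g nab F \<longleftrightarrow>
     riemannian_manifold A g \<and> levi_civita A g nab \<and> tensor11 A F \<and>
     (\<forall>p u. F p (F p u) = u) \<and>
     F \<noteq> (\<lambda>p u. u) \<and> F \<noteq> (\<lambda>p u. - u) \<and>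
     (\<forall>p u v. g p (F p u) (F p v) = g p u v) \<and>
     (\<forall>X Y. vector_field A X \<longrightarrow> vector_field A Y \<longrightarrow>
        (\<forall>p. nab p (X p) (\<lambda>q. F q (Y q)) - F p (nab p (X p) Y) = 0))"


section \<open>Isometrically immersed submanifolds\<close>

text \<open>Below, \<open>A\<close> is the atlas of the submanifold and \<open>B\<close> that of the ambient manifold.\<close>

definition smooth_map ::
  "('m::topological_space, 'a::euclidean_space) atlas
    \<Rightarrow> ('n::topological_space, 'b::euclidean_space) atlas \<Rightarrow> ('m \<Rightarrow> 'n) \<Rightarrow> bool" where
  "smooth_map A B f \<longleftrightarrow> continuous_on UNIV f \<and>
     (\<forall>c\<in>A. \<forall>d\<in>B. smooth_on (chart_map c ` (chart_dom c \<inter> f -` chart_dom d))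
                          (chart_map d \<circ> f \<circ> chart_inv c))"

definition dmap ::
  "('m, 'a::euclidean_space) atlas \<Rightarrow> ('n, 'b::euclidean_space) atlas \<Rightarrow> ('m \<Rightarrow> 'n)
    \<Rightarrow> 'm \<Rightarrow> 'a \<Rightarrow> 'b" where
  "dmap A B f p u = dfun A (chart_map (chart_at B (f p)) \<circ> f) p u"

definition isometric_immersion ::
  "('m::topological_space, 'a::euclidean_space) atlas \<Rightarrow> ('m \<Rightarrow> 'a \<Rightarrow> 'a \<Rightarrow> real)
    \<Rightarrow> ('n::topological_space, 'b::euclidean_space) atlas \<Rightarrow> ('n \<Rightarrow> 'b \<Rightarrow> 'b \<Rightarrow> real)
    \<Rightarrow> ('m \<Rightarrow> 'n) \<Rightarrow> bool" where
  "isometric_immersion A gM B g f \<longleftrightarrow> smooth_map A B f \<and>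
     (\<forall>p. inj (dmap A B f p)) \<and>
     (\<forall>p u v. g (f p) (dmap A B f p u) (dmap A B f p v) = gM p u v)"

text \<open>Tangent and normal parts of a vector \<open>w\<close> of the ambient manifold at \<open>f p\<close>. The tangent part
  is given as an element of the tangent space of the submanifold itself, the normal part as a
  vector of the ambient manifold.\<close>

definition tan_part ::
  "('m, 'a::euclidean_space) atlas \<Rightarrow> ('n, 'b::euclidean_space) atlas \<Rightarrow> ('n \<Rightarrow> 'b \<Rightarrow> 'b \<Rightarrow> real)
    \<Rightarrow> ('m \<Rightarrow> 'n) \<Rightarrow> 'm \<Rightarrow> 'b \<Rightarrow> 'a" where
  "tan_part A B g f p w = (THE u. \<forall>v. g (f p) (w - dmap A B f p u) (dmap A B f p v) = 0)"

definition nor_part ::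
  "('m, 'a::euclidean_space) atlas \<Rightarrow> ('n, 'b::euclidean_space) atlas \<Rightarrow> ('n \<Rightarrow> 'b \<Rightarrow> 'b \<Rightarrow> real)
    \<Rightarrow> ('m \<Rightarrow> 'n) \<Rightarrow> 'm \<Rightarrow> 'b \<Rightarrow> 'b" where
  "nor_part A B g f p w = w - dmap A B f p (tan_part A B g f p w)"

definition normal_space ::
  "('m, 'a::euclidean_space) atlas \<Rightarrow> ('n, 'b::euclidean_space) atlas \<Rightarrow> ('n \<Rightarrow> 'b \<Rightarrow> 'b \<Rightarrow> real)
    \<Rightarrow> ('m \<Rightarrow> 'n) \<Rightarrow> 'm \<Rightarrow> 'b set" where
  "normal_space A B g f p = {w. \<forall>v. g (f p) w (dmap A B f p v) = 0}"

text \<open>Covariant derivative of a field \<open>Y\<close> along \<open>f\<close> (that is, \<open>Y q\<close> is a tangent vector at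
  \<open>f q\<close>), for the pulled back connection. Near \<open>p\<close> write \<open>Y = (\<Sum>i. y\<^sup>i (E\<^sub>i \<circ> f))\<close> with the
  coordinate fields \<open>E\<^sub>i\<close> of the preferred chart at \<open>f p\<close>; the derivative is
  \<open>(\<Sum>i. u(y\<^sup>i) E\<^sub>i + y\<^sup>i nab\<^bsub>df u\<^esub> E\<^sub>i)\<close>. If \<open>Y = Z \<circ> f\<close> near \<open>p\<close> for a field \<open>Z\<close> of the ambient
  manifold, this is \<open>nab (f p) (df u) Z\<close>.\<close>

definition cov_along ::
  "('m, 'a::euclidean_space) atlas \<Rightarrow> ('n, 'b::euclidean_space) atlas \<Rightarrow> ('n, 'b) connection
    \<Rightarrow> ('m \<Rightarrow> 'n) \<Rightarrow> 'm \<Rightarrow> 'a \<Rightarrow> ('m \<Rightarrow> 'b) \<Rightarrow> 'b" where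
  "cov_along A B nab f p u Y =
     (let d = chart_at B (f p); y = (\<lambda>q. vec_in B d (f q) (Y q)) in
      \<Sum>i\<in>Basis. dfun A (\<lambda>q. y q \<bullet> i) p u *\<^sub>R coord_vec B d (f p) i +
                (y p \<bullet> i) *\<^sub>R nab (f p) (dmap A B f p u) (\<lambda>r. coord_vec B d r i))"

definition second_ff ::
  "('m, 'a::euclidean_space) atlas \<Rightarrow> ('n, 'b::euclidean_space) atlas \<Rightarrow> ('n \<Rightarrow> 'b \<Rightarrow> 'b \<Rightarrow> real)
    \<Rightarrow> ('n, 'b) connection \<Rightarrow> ('m \<Rightarrow> 'n) \<Rightarrow> ('m \<Rightarrow> 'a) \<Rightarrow> ('m \<Rightarrow> 'a) \<Rightarrow> 'm \<Rightarrow> 'b" where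
  "second_ff A B g nab f X Y p =
     nor_part A B g f p (cov_along A B nab f p (X p) (\<lambda>q. dmap A B f q (Y q)))"

definition normal_conn ::
  "('m, 'a::euclidean_space) atlas \<Rightarrow> ('n, 'b::euclidean_space) atlas \<Rightarrow> ('n \<Rightarrow> 'b \<Rightarrow> 'b \<Rightarrow> real)
    \<Rightarrow> ('n, 'b) connection \<Rightarrow> ('m \<Rightarrow> 'n) \<Rightarrow> ('m \<Rightarrow> 'a) \<Rightarrow> ('m \<Rightarrow> 'b) \<Rightarrow> 'm \<Rightarrow> 'b" where
  "normal_conn A B g nab f X \<xi> p = nor_part A B g f p (cov_along A B nab f p (X p) \<xi>)"

definition orthonormal_frame ::
  "('m::topological_space, 'a::euclidean_space) atlas \<Rightarrow> ('m \<Rightarrow> 'a \<Rightarrow> 'a \<Rightarrow> real)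
    \<Rightarrow> 'm set \<Rightarrow> (nat \<Rightarrow> 'm \<Rightarrow> 'a) \<Rightarrow> bool" where
  "orthonormal_frame A gM U e \<longleftrightarrow> open U \<and>
     (\<forall>i\<in>{1..DIM('a)}. smooth_vf_on A U (e i)) \<and>
     (\<forall>p\<in>U. \<forall>i\<in>{1..DIM('a)}. \<forall>j\<in>{1..DIM('a)}. gM p (e i p) (e j p) = (if i = j then 1 else 0))"

text \<open>The common value, for all local orthonormal frames \<open>e\<close> around \<open>p\<close>, of the normalised trace
  of the second fundamental form.\<close>

definition mean_curvature ::
  "('m::topological_space, 'a::euclidean_space) atlas \<Rightarrow> ('m \<Rightarrow> 'a \<Rightarrow> 'a \<Rightarrow> real)
    \<Rightarrow> ('n, 'b::euclidean_space) atlas \<Rightarrow> ('n \<Rightarrow> 'b \<Rightarrow> 'b \<Rightarrow> real)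
    \<Rightarrow> ('n, 'b) connection \<Rightarrow> ('m \<Rightarrow> 'n) \<Rightarrow> 'm \<Rightarrow> 'b" where
  "mean_curvature A gM B g nab f p =
     (THE w. \<forall>U e. orthonormal_frame A gM U e \<longrightarrow> p \<in> U \<longrightarrow>
        w = (1 / real DIM('a)) *\<^sub>R (\<Sum>i = 1..DIM('a). second_ff A B g nab f (e i) (e i) p))"

definition minimal_submanifold ::
  "('m::topological_space, 'a::euclidean_space) atlas \<Rightarrow> ('m \<Rightarrow> 'a \<Rightarrow> 'a \<Rightarrow> real)
    \<Rightarrow> ('n, 'b::euclidean_space) atlas \<Rightarrow> ('n \<Rightarrow> 'b \<Rightarrow> 'b \<Rightarrow> real)
    \<Rightarrow> ('n, 'b) connection \<Rightarrow> ('m \<Rightarrow> 'n) \<Rightarrow> bool" where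
  "minimal_submanifold A gM B g nab f \<longleftrightarrow> (\<forall>p. mean_curvature A gM B g nab f p = 0)"

definition pseudo_umbilical ::
  "('m::topological_space, 'a::euclidean_space) atlas \<Rightarrow> ('m \<Rightarrow> 'a \<Rightarrow> 'a \<Rightarrow> real)
    \<Rightarrow> ('n, 'b::euclidean_space) atlas \<Rightarrow> ('n \<Rightarrow> 'b \<Rightarrow> 'b \<Rightarrow> real)
    \<Rightarrow> ('n, 'b) connection \<Rightarrow> ('m \<Rightarrow> 'n) \<Rightarrow> bool" where
  "pseudo_umbilical A gM B g nab f \<longleftrightarrow>
     (let H = mean_curvature A gM B g nab f in
      \<forall>X Y. vector_field A X \<longrightarrow> vector_field A Y \<longrightarrow>
        (\<forall>p. g (f p) (second_ff A B g nab f X Y p) (H p) =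
             gM p (X p) (Y p) * g (f p) (H p) (H p)))"


section \<open>The product structure along the submanifold\<close>

text \<open>The decompositions \<open>F X = \<phi> X + \<omega> X\<close> and \<open>F \<xi> = B \<xi> + C \<xi>\<close> of tangent fields \<open>X\<close> and
  normal fields \<open>\<xi>\<close>; the tangential operator \<open>B\<close> is called \<open>Bop\<close>.\<close>

definition phi ::
  "('m, 'a::euclidean_space) atlas \<Rightarrow> ('n, 'b::euclidean_space) atlas \<Rightarrow> ('n \<Rightarrow> 'b \<Rightarrow> 'b \<Rightarrow> real)
    \<Rightarrow> ('n \<Rightarrow> 'b \<Rightarrow> 'b) \<Rightarrow> ('m \<Rightarrow> 'n) \<Rightarrow> ('m \<Rightarrow> 'a) \<Rightarrow> 'm \<Rightarrow> 'a" where
  "phi A B g F f X p = tan_part A B g f p (F (f p) (dmap A B f p (X p)))"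

definition omega ::
  "('m, 'a::euclidean_space) atlas \<Rightarrow> ('n, 'b::euclidean_space) atlas \<Rightarrow> ('n \<Rightarrow> 'b \<Rightarrow> 'b \<Rightarrow> real)
    \<Rightarrow> ('n \<Rightarrow> 'b \<Rightarrow> 'b) \<Rightarrow> ('m \<Rightarrow> 'n) \<Rightarrow> ('m \<Rightarrow> 'a) \<Rightarrow> 'm \<Rightarrow> 'b" where
  "omega A B g F f X p = nor_part A B g f p (F (f p) (dmap A B f p (X p)))"

definition Bop ::
  "('m, 'a::euclidean_space) atlas \<Rightarrow> ('n, 'b::euclidean_space) atlas \<Rightarrow> ('n \<Rightarrow> 'b \<Rightarrow> 'b \<Rightarrow> real)
    \<Rightarrow> ('n \<Rightarrow> 'b \<Rightarrow> 'b) \<Rightarrow> ('m \<Rightarrow> 'n) \<Rightarrow> ('m \<Rightarrow> 'b) \<Rightarrow> 'm \<Rightarrow> 'a" where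
  "Bop A B g F f \<xi> p = tan_part A B g f p (F (f p) (\<xi> p))"

definition Cop ::
  "('m, 'a::euclidean_space) atlas \<Rightarrow> ('n, 'b::euclidean_space) atlas \<Rightarrow> ('n \<Rightarrow> 'b \<Rightarrow> 'b \<Rightarrow> real)
    \<Rightarrow> ('n \<Rightarrow> 'b \<Rightarrow> 'b) \<Rightarrow> ('m \<Rightarrow> 'n) \<Rightarrow> ('m \<Rightarrow> 'b) \<Rightarrow> 'm \<Rightarrow> 'b" where
  "Cop A B g F f \<xi> p = nor_part A B g f p (F (f p) (\<xi> p))"

definition cov_deriv_C ::
  "('m, 'a::euclidean_space) atlas \<Rightarrow> ('n, 'b::euclidean_space) atlas \<Rightarrow> ('n \<Rightarrow> 'b \<Rightarrow> 'b \<Rightarrow> real)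
    \<Rightarrow> ('n, 'b) connection \<Rightarrow> ('n \<Rightarrow> 'b \<Rightarrow> 'b) \<Rightarrow> ('m \<Rightarrow> 'n)
    \<Rightarrow> ('m \<Rightarrow> 'a) \<Rightarrow> ('m \<Rightarrow> 'b) \<Rightarrow> 'm \<Rightarrow> 'b" where
  "cov_deriv_C A B g nab F f X \<xi> p =
     normal_conn A B g nab f X (Cop A B g F f \<xi>) p -
     Cop A B g F f (normal_conn A B g nab f X \<xi>) p"

text \<open>A distribution is a smooth subbundle of constant rank \<open>k\<close> of the tangent bundle;
  \<open>k = 0\<close> is allowed.\<close>

definition distribution ::
  "('m::topological_space, 'a::euclidean_space) atlas \<Rightarrow> ('m \<Rightarrow> 'a set) \<Rightarrow> bool" where
  "distribution A D \<longleftrightarrow>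
     (\<exists>k::nat. \<forall>p. \<exists>U e. open U \<and> p \<in> U \<and> (\<forall>i<k. smooth_vf_on A U (e i)) \<and>
        (\<forall>q\<in>U. inj_on (\<lambda>i. e i q) {..<k} \<and> independent ((\<lambda>i. e i q) ` {..<k}) \<and>
               D q = span ((\<lambda>i. e i q) ` {..<k})))"

text \<open>Orthogonality of the two distributions need not be demanded: it follows from \<open>F\<close> being
  isometric.\<close>

definition semi_invariant ::
  "('m::topological_space, 'a::euclidean_space) atlas
    \<Rightarrow> ('n, 'b::euclidean_space) atlas \<Rightarrow> ('n \<Rightarrow> 'b \<Rightarrow> 'b \<Rightarrow> real)
    \<Rightarrow> ('n \<Rightarrow> 'b \<Rightarrow> 'b) \<Rightarrow> ('m \<Rightarrow> 'n) \<Rightarrow> bool" where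
  "semi_invariant A B g F f \<longleftrightarrow>
     (\<exists>D D'. distribution A D \<and> distribution A D' \<and>
        (\<forall>p. (\<forall>u. \<exists>v\<in>D p. \<exists>w\<in>D' p. u = v + w) \<and> D p \<inter> D' p = {0} \<and>
             F (f p) ` (dmap A B f p ` D p) = dmap A B f p ` D p \<and>
             F (f p) ` (dmap A B f p ` D' p) \<subseteq> normal_space A B g f p))"

end

theory Submission
  imports Defs
begin

text \<open>
  Write \<open>D\<close> for the covariant derivative of fields along \<open>f\<close> and \<open>T\<close>, \<open>N\<close> for tangent and normal
  parts. As \<open>F\<close> is parallel, \<open>D\<close> commutes with \<open>F\<close>. Applying \<open>N \<circ> D\<^sub>u\<close> to \<open>F H = df (B H) + C H\<close>
  gives, for every tangent vector \<open>u\<close>,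
  \<open>(\<nabla>\<^sub>u C) H + h(u, B H) = N (F (D\<^sub>u H)) - C (N (D\<^sub>u H)) = \<omega> (T (D\<^sub>u H))\<close> (\<open>cov_deriv_C_eq\<close>).
  Differentiating \<open>g(H, df V) = 0\<close> along \<open>u\<close> gives \<open>g(T (D\<^sub>u H), V) = - g(h(u, V), H)\<close>, and
  pseudo-umbilicity turns this into \<open>T (D\<^sub>u H) = - g(H, H) u\<close> (\<open>tan_cov_mean_curvature\<close>). With
  \<open>u = \<phi> X\<close>, pairing with \<open>C H\<close> shows that at each point the identity says
  \<open>g(H, H) g(\<omega> \<phi> X, C H) = 0\<close>. Where \<open>H\<close> vanishes, so does \<open>C H\<close>; hence the identity is equivalent
  to condition (3). Conditions (1) and (2) are special cases of (3): the first forces \<open>C H = 0\<close>, the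
  second \<open>\<omega> \<phi> = 0\<close> (\<open>semi_invariant_omega_phi\<close>). So the disjunction is equivalent to (3) as well.

  Two kinds of preparation make this computation legitimate. First, \<open>H\<close> has to be a differentiable
  field along \<open>f\<close>. It is described by local orthonormal frames, which exist by \<open>gram_schmidt\<close> and all
  give the same trace by \<open>sff_trace_frame_independent\<close>; and \<open>D\<close> is described by charts that jump with
  the point, so that smoothness of \<open>D\<^sub>X Y\<close> (\<open>cov_smooth\<close>) rests on the same formula being valid in
  every chart (\<open>cov_in_chart\<close>). Secondly, parallelism of \<open>F\<close> and pseudo-umbilicity speak about global
  vector fields only. The bump functions of \<open>ex_bump\<close> extend local fields to global ones, which gives
  parallelism on coordinate fields (\<open>F_parallel_coord\<close>) and global fields with prescribed value at a
  point (\<open>ex_vector_field\<close>).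
\<close>

section \<open>Calculus of smooth functions on Euclidean spaces\<close>

text \<open>\<open>frechet_derivative\<close> is a choice from the set of all derivatives at \<open>x\<close>, and that set depends
  on the germ only.\<close>

lemma frechet_derivative_cong_open:
  assumes "open T" "x \<in> T" "\<And>y. y \<in> T \<Longrightarrow> f y = g y"
  shows "frechet_derivative f (at x) = frechet_derivative g (at x)"
proof -
  have "(f has_derivative D) (at x) \<longleftrightarrow> (g has_derivative D) (at x)" for D
    using has_derivative_transform_within_open[of _ _ x UNIV T] assms by (metis)
  then show ?thesis unfolding frechet_derivative_def by simp
qed

lemma differentiable_cong_open:
  assumes "open T" "x \<in> T" "\<And>y. y \<in> T \<Longrightarrow> f y = g y" "f differentiable (at x)"
  shows "g differentiable (at x)"
  using assms has_derivative_transform_within_open[of _ _ x UNIV T]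
  unfolding differentiable_def by metis

lemma differentiable_onD:
  assumes "open S" "x \<in> S" "f differentiable_on S" shows "f differentiable (at x)"
  using assms differentiable_on_eq_differentiable_at by blast

lemma Ck_on_cong:
  assumes "open S" "\<And>x. x \<in> S \<Longrightarrow> f x = g x" "Ck_on k S f"
  shows "Ck_on k S g"
  using assms(2,3)
proof (induction k arbitrary: f g)
  case 0 then show ?case by (auto cong: continuous_on_cong)
next
  case (Suc k)
  have "g differentiable_on S"
    using Suc.prems assms(1) by (simp add: differentiable_on_eq_differentiable_at) (metis differentiable_cong_open)
  moreover have "Ck_on k S (\<lambda>x. frechet_derivative g (at x) v)" for v
  proof (rule Suc.IH)
    show "frechet_derivative f (at x) v = frechet_derivative g (at x) v" if "x \<in> S" for x
      using frechet_derivative_cong_open[OF assms(1) that] Suc.prems(1) by metis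
    show "Ck_on k S (\<lambda>x. frechet_derivative f (at x) v)" using Suc.prems by simp
  qed
  ultimately show ?case by simp
qed

lemma Ck_on_SucI:
  assumes "open S" "\<And>x. x \<in> S \<Longrightarrow> (f has_derivative D x) (at x)" "\<And>v. Ck_on k S (\<lambda>x. D x v)"
  shows "Ck_on (Suc k) S f"
proof -
  have "f differentiable_on S"
    using assms by (auto simp: differentiable_on_eq_differentiable_at differentiable_def)
  moreover have "Ck_on k S (\<lambda>x. frechet_derivative f (at x) v)" for v
    by (rule Ck_on_cong[OF assms(1) _ assms(3)[of v]]) (metis assms(2) frechet_derivative_at)
  ultimately show ?thesis by simp
qed

lemma Ck_on_Suc_has_derivative:
  assumes "open S" "x \<in> S" "Ck_on (Suc k) S f"
  shows "(f has_derivative frechet_derivative f (at x)) (at x)"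
  using assms differentiable_onD frechet_derivative_works by (metis Ck_on.simps(2))

lemma Ck_on_SucD: "Ck_on (Suc k) S f \<Longrightarrow> Ck_on k S f"
  by (induction k arbitrary: f) (auto simp: differentiable_imp_continuous_on)

lemma Ck_on_subset: "Ck_on k S f \<Longrightarrow> T \<subseteq> S \<Longrightarrow> Ck_on k T f"
  by (induction k arbitrary: f) (auto intro: continuous_on_subset differentiable_on_subset)

lemma Ck_on_local:
  assumes "\<And>x. x \<in> S \<Longrightarrow> \<exists>T. open T \<and> x \<in> T \<and> Ck_on k T f"
  shows "Ck_on k S f"
  using assms
proof (induction k arbitrary: f)
  case 0
  have "isCont f x" if "x \<in> S" for x
    using 0[OF that] continuous_on_eq_continuous_at by fastforce
  then show ?case by (simp add: continuous_at_imp_continuous_on)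
next
  case (Suc k)
  have "f differentiable (at x)" if "x \<in> S" for x
    using Suc.prems[OF that] differentiable_onD by auto
  then have "f differentiable_on S"
    by (simp add: differentiable_at_imp_differentiable_on)
  moreover have "Ck_on k S (\<lambda>x. frechet_derivative f (at x) v)" for v
  proof (rule Suc.IH)
    fix x assume "x \<in> S"
    then show "\<exists>T. open T \<and> x \<in> T \<and> Ck_on k T (\<lambda>x. frechet_derivative f (at x) v)"
      using Suc.prems by fastforce
  qed
  ultimately show ?case by simp
qed

lemma Ck_on_const: "Ck_on k S (\<lambda>x. c)"
  by (induction k arbitrary: c) auto

lemma Ck_on_add:
  assumes "open S" "Ck_on k S f" "Ck_on k S g"
  shows "Ck_on k S (\<lambda>x. f x + g x)"
  using assms(2,3)
proof (induction k arbitrary: f g)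
  case 0 then show ?case by (auto intro: continuous_intros)
next
  case (Suc k)
  show ?case
  proof (rule Ck_on_SucI[OF assms(1)])
    show "((\<lambda>x. f x + g x) has_derivative
        (\<lambda>v. frechet_derivative f (at x) v + frechet_derivative g (at x) v)) (at x)" if "x \<in> S" for x
      using that Suc.prems assms(1) by (intro has_derivative_add Ck_on_Suc_has_derivative)
    show "Ck_on k S (\<lambda>x. frechet_derivative f (at x) v + frechet_derivative g (at x) v)" for v
      using Suc by auto
  qed
qed

lemma Ck_on_bounded_linear:
  assumes "bounded_linear L" "open S" "Ck_on k S f"
  shows "Ck_on k S (\<lambda>x. L (f x))"
  using assms(3)
proof (induction k arbitrary: f)
  case 0 then show ?case using bounded_linear.continuous_on[OF assms(1)] by auto
next
  case (Suc k)
  show ?case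
  proof (rule Ck_on_SucI[OF assms(2)])
    show "((\<lambda>x. L (f x)) has_derivative (\<lambda>v. L (frechet_derivative f (at x) v))) (at x)" if "x \<in> S" for x
      using that Suc.prems assms(2) by (intro bounded_linear.has_derivative[OF assms(1)] Ck_on_Suc_has_derivative)
    show "Ck_on k S (\<lambda>x. L (frechet_derivative f (at x) v))" for v
      using Suc by auto
  qed
qed

lemma Ck_on_bounded_bilinear:
  assumes "bounded_bilinear P" "open S" "Ck_on k S f" "Ck_on k S g"
  shows "Ck_on k S (\<lambda>x. P (f x) (g x))"
  using assms(3,4)
proof (induction k arbitrary: f g)
  case 0 then show ?case using bounded_bilinear.continuous_on[OF assms(1)] by auto
next
  case (Suc k)
  show ?case
  proof (rule Ck_on_SucI[OF assms(2)])
    show "((\<lambda>x. P (f x) (g x)) has_derivative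
       (\<lambda>v. P (f x) (frechet_derivative g (at x) v) + P (frechet_derivative f (at x) v) (g x))) (at x)"
      if "x \<in> S" for x
      using that Suc.prems assms(2)
      by (intro bounded_bilinear.FDERIV[OF assms(1)] Ck_on_Suc_has_derivative)
    show "Ck_on k S (\<lambda>x. P (f x) (frechet_derivative g (at x) v) + P (frechet_derivative f (at x) v) (g x))" for v
      using Suc.prems Ck_on_SucD[OF Suc.prems(1)] Ck_on_SucD[OF Suc.prems(2)]
      by (intro Ck_on_add[OF assms(2)] Suc.IH) auto
  qed
qed

lemma Ck_on_sum:
  assumes "open S" "\<And>i. i \<in> I \<Longrightarrow> Ck_on k S (f i)"
  shows "Ck_on k S (\<lambda>x. \<Sum>i\<in>I. f i x)"
  using assms by (induction I rule: infinite_finite_induct) (auto intro!: Ck_on_const Ck_on_add)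

lemma linear_euclidean_expansion:
  assumes "linear L"
  shows "L v = (\<Sum>i\<in>Basis. (v \<bullet> i) *\<^sub>R L i)"
proof -
  have "L v = L (\<Sum>i\<in>Basis. (v \<bullet> i) *\<^sub>R i)" by (simp add: euclidean_representation)
  also have "\<dots> = (\<Sum>i\<in>Basis. (v \<bullet> i) *\<^sub>R L i)"
    by (simp only: linear_sum[OF assms] linear_cmul[OF assms])
  finally show ?thesis .
qed

text \<open>The chain rule has to be expanded in a basis: \<open>Ck_on\<close> speaks about derivatives of \<open>g\<close> in fixed
  directions, whereas the inner derivative is a direction that varies with the point. Expanded, the
  derivative of the composite consists of products, to which the induction hypothesis applies.\<close>

lemma Ck_on_compose:
  fixes f :: "'a::euclidean_space \<Rightarrow> 'c::euclidean_space" and g :: "'c \<Rightarrow> 'v::real_normed_vector"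
  assumes "open S" "open T" "f ` S \<subseteq> T" "Ck_on k S f" "Ck_on k T g"
  shows "Ck_on k S (\<lambda>x. g (f x))"
  using assms(4,5)
proof (induction k arbitrary: g)
  case 0 then show ?case using continuous_on_compose2[of T g S f] assms(3) by simp
next
  case (Suc k)
  let ?D = "\<lambda>x v. \<Sum>i\<in>Basis. (frechet_derivative f (at x) v \<bullet> i) *\<^sub>R frechet_derivative g (at (f x)) i"
  show ?case
  proof (rule Ck_on_SucI[OF assms(1)])
    fix x assume x: "x \<in> S"
    then have fx: "f x \<in> T" using assms(3) by auto
    have g': "(g has_derivative frechet_derivative g (at (f x))) (at (f x))"
      using Suc.prems(2) Ck_on_Suc_has_derivative[OF assms(2) fx] by blast
    have f': "(f has_derivative frechet_derivative f (at x)) (at x)"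
      using Suc.prems(1) Ck_on_Suc_has_derivative[OF assms(1) x] by blast
    have lin: "linear (frechet_derivative g (at (f x)))"
      using g' by (rule has_derivative_linear)
    have "frechet_derivative g (at (f x)) (frechet_derivative f (at x) v) = ?D x v" for v
      using linear_euclidean_expansion[OF lin] by blast
    then show "((\<lambda>x. g (f x)) has_derivative ?D x) (at x)"
      using has_derivative_compose[OF f' g'] by simp
  next
    fix v
    have "Ck_on k S (\<lambda>x. frechet_derivative g (at (f x)) i)" for i
      using Suc.IH[of "\<lambda>y. frechet_derivative g (at y) i"] Suc.prems(2) Ck_on_SucD[OF Suc.prems(1)] by simp
    moreover have "Ck_on k S (\<lambda>x. frechet_derivative f (at x) v \<bullet> i)" for i
      using Suc.prems by (intro Ck_on_bounded_linear[OF bounded_linear_inner_left assms(1)]) auto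
    ultimately show "Ck_on k S (\<lambda>x. ?D x v)"
      by (intro Ck_on_sum[OF assms(1)] Ck_on_bounded_bilinear[OF bounded_bilinear_scaleR assms(1)])
  qed
qed

lemma smooth_onI_Ck: "(\<And>k. Ck_on k S f) \<Longrightarrow> smooth_on S f"
  by (simp add: smooth_on_def)

lemma smooth_on_cong:
  assumes "open S" "\<And>x. x \<in> S \<Longrightarrow> f x = g x" "smooth_on S f"
  shows "smooth_on S g"
  using assms Ck_on_cong unfolding smooth_on_def by metis

lemma smooth_on_subset: "smooth_on S f \<Longrightarrow> T \<subseteq> S \<Longrightarrow> smooth_on T f"
  using Ck_on_subset unfolding smooth_on_def by metis

lemma smooth_on_local:
  assumes "\<And>x. x \<in> S \<Longrightarrow> \<exists>T. open T \<and> x \<in> T \<and> smooth_on T f"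
  shows "smooth_on S f"
  unfolding smooth_on_def
  by (intro allI Ck_on_local) (meson assms smooth_on_def)

lemma smooth_on_const: "smooth_on S (\<lambda>x. c)"
  by (simp add: smooth_on_def Ck_on_const)

lemma smooth_on_differentiable:
  assumes "open S" "x \<in> S" "smooth_on S f"
  shows "f differentiable (at x)"
  using assms differentiable_onD unfolding smooth_on_def by (metis Ck_on.simps(2))

lemma smooth_on_derivative:
  "smooth_on S f \<Longrightarrow> smooth_on S (\<lambda>x. frechet_derivative f (at x) v)"
  unfolding smooth_on_def by (metis Ck_on.simps(2))

lemma smooth_on_add:
  "open S \<Longrightarrow> smooth_on S f \<Longrightarrow> smooth_on S g \<Longrightarrow> smooth_on S (\<lambda>x. f x + g x)"
  by (simp add: smooth_on_def Ck_on_add)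

lemma smooth_on_bounded_linear:
  "bounded_linear L \<Longrightarrow> open S \<Longrightarrow> smooth_on S f \<Longrightarrow> smooth_on S (\<lambda>x. L (f x))"
  by (simp add: smooth_on_def Ck_on_bounded_linear)

lemma smooth_on_bounded_bilinear:
  "bounded_bilinear P \<Longrightarrow> open S \<Longrightarrow> smooth_on S f \<Longrightarrow> smooth_on S g \<Longrightarrow>
   smooth_on S (\<lambda>x. P (f x) (g x))"
  by (simp add: smooth_on_def Ck_on_bounded_bilinear)

lemma smooth_on_sum:
  "open S \<Longrightarrow> (\<And>i. i \<in> I \<Longrightarrow> smooth_on S (f i)) \<Longrightarrow> smooth_on S (\<lambda>x. \<Sum>i\<in>I. f i x)"
  by (simp add: smooth_on_def Ck_on_sum)

lemma smooth_on_compose: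
  fixes f :: "'a::euclidean_space \<Rightarrow> 'c::euclidean_space" and g :: "'c \<Rightarrow> 'v::real_normed_vector"
  shows "open S \<Longrightarrow> open T \<Longrightarrow> f ` S \<subseteq> T \<Longrightarrow> smooth_on S f \<Longrightarrow> smooth_on T g \<Longrightarrow>
    smooth_on S (\<lambda>x. g (f x))"
  unfolding smooth_on_def using Ck_on_compose by blast

lemma smooth_on_ident: "smooth_on S (\<lambda>x. x)"
proof -
  have "Ck_on k S (\<lambda>x. x)" for k :: nat
    by (cases k) (auto simp: Ck_on_const)
  then show ?thesis by (simp add: smooth_on_def)
qed

lemma Ck_on_SucI_real:
  fixes f :: "real \<Rightarrow> real"
  assumes "open S" "\<And>x. x \<in> S \<Longrightarrow> (f has_real_derivative f' x) (at x)" "Ck_on k S f'"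
  shows "Ck_on (Suc k) S f"
proof (rule Ck_on_SucI[OF assms(1)])
  show "(f has_derivative (\<lambda>v. f' x * v)) (at x)" if "x \<in> S" for x
    using assms(2)[OF that] by (simp add: has_field_derivative_def)
  show "Ck_on k S (\<lambda>x. f' x * v)" for v
    by (intro Ck_on_bounded_linear[OF bounded_linear_mult_left assms(1,3)])
qed

text \<open>The exponent \<open>- 1 / 2\<close> serves to normalise vectors.\<close>

lemma smooth_on_powr: "smooth_on {0<..} (\<lambda>x::real. x powr a)"
proof (rule smooth_onI_Ck)
  show "Ck_on k {0<..} (\<lambda>x::real. x powr a)" for k
  proof (induction k arbitrary: a)
    case 0 then show ?case by (auto intro!: continuous_intros)
  next
    case (Suc k)
    show ?case
    proof (rule Ck_on_SucI_real)
      show "((\<lambda>x. x powr a) has_real_derivative a * x powr (a - 1)) (at x)" if "x \<in> {0<..}" for x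
        using that by (auto intro!: has_real_derivative_powr)
      show "Ck_on k {0<..} (\<lambda>x. a * x powr (a - 1))"
        by (intro Ck_on_bounded_linear[OF bounded_linear_mult_right] Suc) auto
    qed auto
  qed
qed

text \<open>The powers of \<open>t\<close> in the denominator make the family closed under differentiation up to linear
  combinations, so one induction on the order of differentiability treats all members at once.\<close>

definition flat_exp :: "nat \<Rightarrow> real \<Rightarrow> real" where
  "flat_exp n t = (if t > 0 then exp (- 1 / t) / t ^ n else 0)"

lemma flat_exp_tendsto_0: "(flat_exp n \<longlongrightarrow> 0) (at 0)"
proof -
  have "((\<lambda>t::real. inverse t ^ n / exp (inverse t)) \<longlongrightarrow> 0) (at_right 0)"
    by (rule filterlim_compose[OF tendsto_power_div_exp_0 filterlim_inverse_at_top_right])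
  moreover have "eventually (\<lambda>t. inverse t ^ n / exp (inverse t) = flat_exp n t) (at_right (0::real))"
    unfolding eventually_at_right_field
    by (intro exI[of _ 1]) (auto simp: flat_exp_def exp_minus divide_simps power_inverse inverse_eq_divide exp_minus_inverse)
  ultimately have right: "(flat_exp n \<longlongrightarrow> 0) (at_right 0)"
    by (rule Lim_transform_eventually)
  have "eventually (\<lambda>t. 0 = flat_exp n t) (at_left (0::real))"
    unfolding eventually_at_left_field
    by (intro exI[of _ "-1"]) (auto simp: flat_exp_def)
  then have "(flat_exp n \<longlongrightarrow> 0) (at_left 0)"
    by (rule Lim_transform_eventually[OF tendsto_const])
  with right show ?thesis by (simp add: filterlim_at_split)
qed

text \<open>At \<open>0\<close> the difference quotient of \<open>flat_exp n\<close> is \<open>flat_exp (n + 1)\<close>, which tends to \<open>0\<close>.\<close>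

lemma flat_exp_has_derivative:
  "(flat_exp n has_real_derivative flat_exp (n + 2) t - real n * flat_exp (n + 1) t) (at t)"
proof (cases t "0::real" rule: linorder_cases)
  case less
  have "((\<lambda>t. 0) has_real_derivative 0) (at t)" by simp
  then have "(flat_exp n has_real_derivative 0) (at t)"
    by (rule has_field_derivative_transform_within_open[of _ _ _ "{..<0}"]) (use less in \<open>auto simp: flat_exp_def\<close>)
  then show ?thesis using less by (simp add: flat_exp_def)
next
  case equal
  have "((\<lambda>h. flat_exp n h / h) \<longlongrightarrow> 0) (at 0)"
    by (rule Lim_transform_eventually[OF flat_exp_tendsto_0[of "Suc n"]])
       (auto simp: flat_exp_def eventually_at_filter)
  then show ?thesis using equal by (simp add: has_field_derivative_iff flat_exp_def)
next
  case greater
  have pow: "t ^ m = t * t ^ (m - Suc 0)" if "m \<noteq> 0" for m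
    using that by (cases m) auto
  have "((\<lambda>t. exp (- 1 / t) / t ^ n) has_real_derivative flat_exp (n + 2) t - real n * flat_exp (n + 1) t) (at t)"
    using greater
    by (cases n) (auto intro!: derivative_eq_intros
        simp: flat_exp_def field_simps power2_eq_square intro: pow)
  then show ?thesis
    by (rule has_field_derivative_transform_within_open[of _ _ _ "{0<..}"]) (use greater in \<open>auto simp: flat_exp_def\<close>)
qed

lemma smooth_flat_exp: "smooth_on UNIV (flat_exp n)"
proof (rule smooth_onI_Ck)
  show "Ck_on k UNIV (flat_exp n)" for k
  proof (induction k arbitrary: n)
    case 0
    have "isCont (flat_exp n) t" for t using flat_exp_has_derivative DERIV_isCont by blast
    then show ?case by (simp add: continuous_at_imp_continuous_on)
  next
    case (Suc k)
    have "Ck_on k UNIV (\<lambda>t. flat_exp (n + 2) t + (- real n) * flat_exp (n + 1) t)"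
      by (intro Ck_on_add Ck_on_bounded_linear[OF bounded_linear_mult_right] Suc) auto
    then have "Ck_on k UNIV (\<lambda>t. flat_exp (n + 2) t - real n * flat_exp (n + 1) t)" by simp
    with flat_exp_has_derivative show ?case by (intro Ck_on_SucI_real) auto
  qed
qed

lemma ex_smooth_bump:
  fixes x0 :: "'a::euclidean_space"
  assumes "r > 0"
  shows "\<exists>\<psi>::'a \<Rightarrow> real. smooth_on UNIV \<psi> \<and> \<psi> x0 = 1 \<and> (\<forall>x. x \<notin> cball x0 r \<longrightarrow> \<psi> x = 0)"
proof -
  define \<psi> where "\<psi> x = flat_exp 0 (r\<^sup>2 + - ((x + - x0) \<bullet> (x + - x0))) / flat_exp 0 (r\<^sup>2)" for x
  have "smooth_on UNIV (\<lambda>x. r\<^sup>2 + - ((x + - x0) \<bullet> (x + - x0)))"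
    by (intro smooth_on_add smooth_on_const smooth_on_bounded_linear[OF bounded_linear_minus[OF bounded_linear_ident]]
        smooth_on_bounded_bilinear[OF bounded_bilinear_inner] smooth_on_ident) auto
  then have "smooth_on UNIV (\<lambda>x. flat_exp 0 (r\<^sup>2 + - ((x + - x0) \<bullet> (x + - x0))))"
    using smooth_on_compose[OF open_UNIV open_UNIV _ _ smooth_flat_exp] by blast
  then have "smooth_on UNIV \<psi>"
    unfolding \<psi>_def by (rule smooth_on_bounded_linear[OF bounded_linear_divide open_UNIV])
  moreover have "\<psi> x0 = 1" using assms by (simp add: \<psi>_def flat_exp_def)
  moreover have "\<psi> x = 0" if "x \<notin> cball x0 r" for x
  proof -
    have "(x - x0) \<bullet> (x - x0) > r\<^sup>2"
      using that assms by (simp add: dist_norm norm_minus_commute power2_norm_eq_inner[symmetric] power_strict_mono)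
    then show ?thesis by (simp add: \<psi>_def flat_exp_def)
  qed
  ultimately show ?thesis by blast
qed

section \<open>Functions and vector fields on a smooth manifold\<close>

locale smooth_manifold =
  fixes A :: "('m::{t2_space, second_countable_topology}, 'a::euclidean_space) atlas"
  assumes smooth_atlas: "smooth_atlas A"
begin

lemma chart_at_mem: "chart_at A p \<in> A" and chart_at_dom: "p \<in> chart_dom (chart_at A p)"
proof -
  have "\<exists>c. c \<in> A \<and> p \<in> chart_dom c"
    using smooth_atlas unfolding smooth_atlas_def by blast
  from someI_ex[OF this] show "chart_at A p \<in> A" "p \<in> chart_dom (chart_at A p)"
    unfolding chart_at_def by auto
qed

lemma is_chart: "c \<in> A \<Longrightarrow> is_chart c"
  using smooth_atlas unfolding smooth_atlas_def by blast

lemma chart_dom_open: "c \<in> A \<Longrightarrow> open (chart_dom c)"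
  using is_chart unfolding is_chart_def by blast

lemma chart_homeo:
  "c \<in> A \<Longrightarrow> homeomorphism (chart_dom c) (chart_map c ` chart_dom c) (chart_map c) (chart_inv c)"
  using is_chart unfolding is_chart_def by blast

lemma chart_inv_map: "c \<in> A \<Longrightarrow> p \<in> chart_dom c \<Longrightarrow> chart_inv c (chart_map c p) = p"
  using chart_homeo homeomorphism_apply1 by blast

lemma chart_map_image_open:
  assumes "c \<in> A" "open U"
  shows "open (chart_map c ` (chart_dom c \<inter> U))"
proof -
  have "openin (top_of_set (chart_map c ` chart_dom c)) (chart_map c ` (chart_dom c \<inter> U))"
    by (rule homeomorphism_imp_open_map[OF chart_homeo[OF assms(1)]]) (use assms(2) in auto)
  then show ?thesis
    using is_chart[OF assms(1)] openin_open_trans unfolding is_chart_def by blast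
qed

lemma transition_smooth:
  assumes "c \<in> A" "d \<in> A"
  shows "smooth_on (chart_map c ` (chart_dom c \<inter> chart_dom d)) (\<lambda>x. chart_map d (chart_inv c x))"
  using smooth_atlas assms unfolding smooth_atlas_def by (simp add: comp_def)

subsection \<open>Smooth functions\<close>

lemma smooth_fun_onD:
  "smooth_fun_on A U s \<Longrightarrow> c \<in> A \<Longrightarrow>
    smooth_on (chart_map c ` (chart_dom c \<inter> U)) (\<lambda>x. s (chart_inv c x))"
  by (simp add: smooth_fun_on_def comp_def)

lemma smooth_fun_onI:
  "(\<And>c. c \<in> A \<Longrightarrow> smooth_on (chart_map c ` (chart_dom c \<inter> U)) (\<lambda>x. s (chart_inv c x))) \<Longrightarrow>
    smooth_fun_on A U s"
  by (simp add: smooth_fun_on_def comp_def)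

lemma smooth_fun_cong:
  assumes "open U" "\<And>q. q \<in> U \<Longrightarrow> s q = t q" "smooth_fun_on A U s"
  shows "smooth_fun_on A U t"
proof (rule smooth_fun_onI)
  fix c assume c: "c \<in> A"
  show "smooth_on (chart_map c ` (chart_dom c \<inter> U)) (\<lambda>x. t (chart_inv c x))"
    by (rule smooth_on_cong[OF chart_map_image_open[OF c assms(1)] _ smooth_fun_onD[OF assms(3) c]])
       (use assms(2) chart_inv_map[OF c] in auto)
qed

lemma smooth_fun_subset: "smooth_fun_on A U s \<Longrightarrow> W \<subseteq> U \<Longrightarrow> smooth_fun_on A W s"
  unfolding smooth_fun_on_def by (meson Int_mono image_mono order_refl smooth_on_subset)

lemma smooth_fun_local:
  assumes "\<And>p. p \<in> U \<Longrightarrow> \<exists>W. open W \<and> p \<in> W \<and> smooth_fun_on A W s"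
  shows "smooth_fun_on A U s"
proof (intro smooth_fun_onI smooth_on_local)
  fix c x assume c: "c \<in> A" and "x \<in> chart_map c ` (chart_dom c \<inter> U)"
  then obtain p where p: "p \<in> chart_dom c" "p \<in> U" "x = chart_map c p" by auto
  obtain W where W: "open W" "p \<in> W" "smooth_fun_on A W s" using assms[OF p(2)] by auto
  show "\<exists>T. open T \<and> x \<in> T \<and> smooth_on T (\<lambda>x. s (chart_inv c x))"
    using chart_map_image_open[OF c W(1)] smooth_fun_onD[OF W(3) c] p W(2) by blast
qed

lemma smooth_fun_const: "smooth_fun_on A U (\<lambda>q. k)"
  by (intro smooth_fun_onI smooth_on_const)

lemma smooth_fun_add:
  "open U \<Longrightarrow> smooth_fun_on A U s \<Longrightarrow> smooth_fun_on A U t \<Longrightarrow> smooth_fun_on A U (\<lambda>q. s q + t q)"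
  by (rule smooth_fun_onI) (intro smooth_on_add smooth_fun_onD chart_map_image_open)

lemma smooth_fun_bounded_linear:
  "bounded_linear L \<Longrightarrow> open U \<Longrightarrow> smooth_fun_on A U s \<Longrightarrow> smooth_fun_on A U (\<lambda>q. L (s q))"
  by (rule smooth_fun_onI, rule smooth_on_bounded_linear, assumption, rule chart_map_image_open,
      assumption+, rule smooth_fun_onD, assumption+)

lemma smooth_fun_bounded_bilinear:
  "bounded_bilinear P \<Longrightarrow> open U \<Longrightarrow> smooth_fun_on A U s \<Longrightarrow> smooth_fun_on A U t \<Longrightarrow>
    smooth_fun_on A U (\<lambda>q. P (s q) (t q))"
  by (rule smooth_fun_onI, rule smooth_on_bounded_bilinear, assumption, rule chart_map_image_open,
      assumption+, rule smooth_fun_onD, assumption+, rule smooth_fun_onD, assumption+)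

lemmas smooth_fun_scaleR = smooth_fun_bounded_bilinear[OF bounded_bilinear_scaleR]
lemmas smooth_fun_mult = smooth_fun_bounded_bilinear[OF bounded_bilinear_mult]
lemmas smooth_fun_inner_left = smooth_fun_bounded_linear[OF bounded_linear_inner_left]

lemma smooth_fun_sum:
  "open U \<Longrightarrow> (\<And>i. i \<in> I \<Longrightarrow> smooth_fun_on A U (s i)) \<Longrightarrow> smooth_fun_on A U (\<lambda>q. \<Sum>i\<in>I. s i q)"
  by (rule smooth_fun_onI) (intro smooth_on_sum smooth_fun_onD chart_map_image_open)

lemma smooth_fun_compose:
  fixes t :: "'m \<Rightarrow> 'c::euclidean_space" and G :: "'c \<Rightarrow> 'v::real_normed_vector"
  assumes "open U" "smooth_fun_on A U t" "open T" "t ` U \<subseteq> T" "smooth_on T G"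
  shows "smooth_fun_on A U (\<lambda>q. G (t q))"
proof (rule smooth_fun_onI)
  fix c assume c: "c \<in> A"
  show "smooth_on (chart_map c ` (chart_dom c \<inter> U)) (\<lambda>x. G (t (chart_inv c x)))"
    by (rule smooth_on_compose[OF chart_map_image_open[OF c assms(1)] assms(3) _ smooth_fun_onD[OF assms(2) c] assms(5)])
       (use assms(4) chart_inv_map[OF c] in auto)
qed

lemma smooth_fun_chart_map: "d \<in> A \<Longrightarrow> smooth_fun_on A (chart_dom d) (chart_map d)"
  by (intro smooth_fun_onI transition_smooth)

lemma smooth_fun_chart_compose:
  assumes "d \<in> A" "open U" "U \<subseteq> chart_dom d" "smooth_on (chart_map d ` U) G"
  shows "smooth_fun_on A U (\<lambda>q. G (chart_map d q))"
proof (rule smooth_fun_compose[OF assms(2) _ _ _ assms(4)])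
  show "smooth_fun_on A U (chart_map d)"
    using smooth_fun_subset smooth_fun_chart_map assms(1,3) by blast
  show "open (chart_map d ` U)"
    using chart_map_image_open[OF assms(1,2)] assms(3) by (simp add: Int_absorb1)
qed auto

text \<open>Smoothness in a single chart that covers \<open>U\<close> suffices, since on \<open>U\<close> the function is the composite
  of its chart representation with the chart map, and chart maps are smooth by smoothness of the
  transitions.\<close>

lemma smooth_fun_chartI:
  assumes "d \<in> A" "open U" "U \<subseteq> chart_dom d" "smooth_on (chart_map d ` U) (\<lambda>x. s (chart_inv d x))"
  shows "smooth_fun_on A U s"
  by (rule smooth_fun_cong[OF assms(2) _ smooth_fun_chart_compose[OF assms]])
     (use assms(3) chart_inv_map[OF assms(1)] in auto)

subsection \<open>Directional derivatives and components\<close>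

lemma smooth_fun_differentiable:
  assumes "open U" "p \<in> U" "smooth_fun_on A U s" "c \<in> A" "p \<in> chart_dom c"
  shows "(\<lambda>x. s (chart_inv c x)) differentiable (at (chart_map c p))"
  by (rule smooth_on_differentiable[OF chart_map_image_open[OF assms(4,1)] _ smooth_fun_onD[OF assms(3,4)]])
     (use assms in auto)

lemma dfun_has_derivative:
  assumes "open U" "p \<in> U" "smooth_fun_on A U s"
  shows "((\<lambda>x. s (chart_inv (chart_at A p) x)) has_derivative dfun A s p) (at (chart_map (chart_at A p) p))"
  using smooth_fun_differentiable[OF assms chart_at_mem chart_at_dom, unfolded frechet_derivative_works]
  unfolding dfun_def comp_def by simp

lemma dfun_eqI:
  assumes "((\<lambda>x. s (chart_inv (chart_at A p) x)) has_derivative D) (at (chart_map (chart_at A p) p))"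
  shows "dfun A s p u = D u"
  using frechet_derivative_at[OF assms] unfolding dfun_def comp_def by simp

lemma dfun_linear:
  assumes "open U" "p \<in> U" "smooth_fun_on A U s"
  shows "linear (dfun A s p)"
  using dfun_has_derivative[OF assms] has_derivative_linear by blast

lemma dfun_cong:
  assumes "open U" "p \<in> U" "\<And>q. q \<in> U \<Longrightarrow> s q = t q"
  shows "dfun A s p u = dfun A t p u"
proof -
  let ?c = "chart_at A p"
  have "frechet_derivative (s \<circ> chart_inv ?c) (at (chart_map ?c p)) =
        frechet_derivative (t \<circ> chart_inv ?c) (at (chart_map ?c p))"
    by (rule frechet_derivative_cong_open[OF chart_map_image_open[OF chart_at_mem assms(1)]])
       (use assms chart_at_dom chart_inv_map[OF chart_at_mem] in auto)
  then show ?thesis by (simp add: dfun_def)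
qed

lemma dfun_const: "dfun A (\<lambda>q. k) p u = 0"
  by (rule dfun_eqI) auto

lemma dfun_add:
  assumes "open U" "p \<in> U" "smooth_fun_on A U s" "smooth_fun_on A U t"
  shows "dfun A (\<lambda>q. s q + t q) p u = dfun A s p u + dfun A t p u"
  by (rule dfun_eqI)
     (rule has_derivative_add[OF dfun_has_derivative[OF assms(1,2,3)] dfun_has_derivative[OF assms(1,2,4)]])

lemma dfun_bounded_bilinear:
  assumes "bounded_bilinear P" "open U" "p \<in> U" "smooth_fun_on A U s" "smooth_fun_on A U t"
  shows "dfun A (\<lambda>q. P (s q) (t q)) p u = P (s p) (dfun A t p u) + P (dfun A s p u) (t p)"
proof -
  have "chart_inv (chart_at A p) (chart_map (chart_at A p) p) = p"
    using chart_inv_map chart_at_mem chart_at_dom by blast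
  with bounded_bilinear.FDERIV[OF assms(1) dfun_has_derivative[OF assms(2-4)] dfun_has_derivative[OF assms(2,3,5)]]
  show ?thesis by (intro dfun_eqI) simp
qed

lemmas dfun_mult = dfun_bounded_bilinear[OF bounded_bilinear_mult]

lemma dfun_sum:
  assumes "open U" "p \<in> U" "\<And>i. i \<in> I \<Longrightarrow> smooth_fun_on A U (s i)"
  shows "dfun A (\<lambda>q. \<Sum>i\<in>I. s i q) p u = (\<Sum>i\<in>I. dfun A (s i) p u)"
  by (rule dfun_eqI) (rule has_derivative_sum, rule dfun_has_derivative[OF assms])

lemma dfun_compose:
  assumes "open U" "p \<in> U" "smooth_fun_on A U t" "G differentiable (at (t p))"
  shows "dfun A (\<lambda>q. G (t q)) p u = frechet_derivative G (at (t p)) (dfun A t p u)"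
proof -
  let ?c = "chart_at A p"
  have "chart_inv ?c (chart_map ?c p) = p"
    using chart_inv_map chart_at_mem chart_at_dom by blast
  then have "(G has_derivative frechet_derivative G (at (t p))) (at (t (chart_inv ?c (chart_map ?c p))))"
    using assms(4) frechet_derivative_works by auto
  from has_derivative_compose[OF dfun_has_derivative[OF assms(1-3)] this]
  show ?thesis by (rule dfun_eqI)
qed

text \<open>Chain rule for \<open>s = (s \<circ> chart_inv c) \<circ> chart_map c\<close>. It lets a derivative, which is taken in the
  preferred chart at \<open>p\<close>, be computed in any chart.\<close>

lemma dfun_chart:
  assumes "open U" "p \<in> U" "smooth_fun_on A U s" "c \<in> A" "p \<in> chart_dom c"
  shows "dfun A s p u = frechet_derivative (\<lambda>x. s (chart_inv c x)) (at (chart_map c p)) (vec_in A c p u)"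
proof -
  have "dfun A s p u = dfun A (\<lambda>q. s (chart_inv c (chart_map c q))) p u"
    by (rule dfun_cong[OF chart_dom_open[OF assms(4)] assms(5)]) (simp add: chart_inv_map assms(4))
  also have "\<dots> = frechet_derivative (\<lambda>x. s (chart_inv c x)) (at (chart_map c p)) (vec_in A c p u)"
    unfolding vec_in_def
    using dfun_compose[OF chart_dom_open[OF assms(4)] assms(5) smooth_fun_chart_map[OF assms(4)] smooth_fun_differentiable[OF assms]] .
  finally show ?thesis .
qed

lemma vec_in_linear: "c \<in> A \<Longrightarrow> p \<in> chart_dom c \<Longrightarrow> linear (vec_in A c p)"
  using dfun_linear[OF chart_dom_open _ smooth_fun_chart_map] unfolding vec_in_def by blast

lemma coord_vec_linear:
  assumes "c \<in> A" "p \<in> chart_dom c" shows "linear (coord_vec A c p)"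
  using smooth_fun_differentiable[OF chart_dom_open chart_at_dom smooth_fun_chart_map, OF chart_at_mem chart_at_mem assms]
    linear_frechet_derivative
  unfolding coord_vec_def comp_def by blast

lemma vec_in_chart_at: "vec_in A (chart_at A p) p u = u"
proof -
  let ?d = "chart_at A p"
  have "dfun A (chart_map ?d) p u = (\<lambda>v. v) u"
  proof (rule dfun_eqI)
    show "((\<lambda>x. chart_map ?d (chart_inv ?d x)) has_derivative (\<lambda>v. v)) (at (chart_map ?d p))"
      by (rule has_derivative_transform_within_open[OF has_derivative_ident chart_map_image_open[OF chart_at_mem open_UNIV, of p]])
         (use chart_at_dom chart_inv_map[OF chart_at_mem] in auto)
  qed
  then show ?thesis by (simp add: vec_in_def)
qed

lemma coord_vec_vec_in:
  assumes "c \<in> A" "p \<in> chart_dom c" shows "coord_vec A c p (vec_in A c p u) = u"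
  using dfun_chart[OF chart_dom_open chart_at_dom smooth_fun_chart_map, OF chart_at_mem chart_at_mem assms]
    vec_in_chart_at[of p u] by (simp add: coord_vec_def comp_def vec_in_def)

text \<open>\<open>coord_vec\<close> is a left inverse of the linear map \<open>vec_in\<close>, hence an inverse, both spaces having the
  same finite dimension.\<close>

lemma vec_in_coord_vec:
  assumes "c \<in> A" "p \<in> chart_dom c" shows "vec_in A c p (coord_vec A c p v) = v"
proof -
  have "inj (vec_in A c p)" by (rule inj_on_inverseI[of _ "coord_vec A c p"]) (simp add: coord_vec_vec_in assms)
  then have "surj (vec_in A c p)" using linear_injective_imp_surjective vec_in_linear assms by blast
  then obtain u where "v = vec_in A c p u" by blast
  then show ?thesis by (simp add: coord_vec_vec_in assms)
qed

lemma coord_vec_expansion: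
  assumes "c \<in> A" "p \<in> chart_dom c"
  shows "u = (\<Sum>i\<in>Basis. (vec_in A c p u \<bullet> i) *\<^sub>R coord_vec A c p i)"
  using linear_euclidean_expansion[OF coord_vec_linear[OF assms], of "vec_in A c p u"] coord_vec_vec_in[OF assms] by simp

subsection \<open>Smooth vector fields\<close>

lemma smooth_vf_onD:
  "smooth_vf_on A U X \<Longrightarrow> c \<in> A \<Longrightarrow>
    smooth_on (chart_map c ` (chart_dom c \<inter> U)) (\<lambda>x. vec_in A c (chart_inv c x) (X (chart_inv c x)))"
  by (simp add: smooth_vf_on_def)

text \<open>In a chart the derivative is the sum of the partial derivatives of \<open>s\<close>, weighted by the components
  of \<open>X\<close>.\<close>

lemma smooth_fun_dfun:
  assumes "open U" "smooth_vf_on A U X" "smooth_fun_on A U s"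
  shows "smooth_fun_on A U (\<lambda>q. dfun A s q (X q))"
proof (rule smooth_fun_onI)
  fix c assume c: "c \<in> A"
  let ?S = "chart_map c ` (chart_dom c \<inter> U)"
  let ?D = "\<lambda>x. frechet_derivative (\<lambda>x. s (chart_inv c x)) (at x)"
  have S: "open ?S" using chart_map_image_open c assms(1) by blast
  let ?y = "\<lambda>x. vec_in A c (chart_inv c x) (X (chart_inv c x))"
  show "smooth_on ?S (\<lambda>x. dfun A s (chart_inv c x) (X (chart_inv c x)))"
  proof (rule smooth_on_cong[OF S])
    show "smooth_on ?S (\<lambda>x. \<Sum>i\<in>Basis. (?y x \<bullet> i) *\<^sub>R ?D x i)"
      by (intro smooth_on_sum[OF S] smooth_on_bounded_bilinear[OF bounded_bilinear_scaleR S]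
          smooth_on_bounded_linear[OF bounded_linear_inner_left S] smooth_on_derivative
          smooth_vf_onD[OF assms(2) c] smooth_fun_onD[OF assms(3) c])
    fix x assume "x \<in> ?S"
    then obtain p where p: "p \<in> chart_dom c" "p \<in> U" "x = chart_map c p" by auto
    have lin: "linear (?D x)"
      using smooth_fun_differentiable[OF assms(1) p(2) assms(3) c p(1)] linear_frechet_derivative p by blast
    show "(\<Sum>i\<in>Basis. (?y x \<bullet> i) *\<^sub>R ?D x i) = dfun A s (chart_inv c x) (X (chart_inv c x))"
      using dfun_chart[OF assms(1) p(2) assms(3) c p(1), of "X p"] linear_euclidean_expansion[OF lin, of "?y x"] p
        chart_inv_map[OF c] by simp
  qed
qed

text \<open>The components of \<open>X\<close> in the chart \<open>d\<close> are the derivatives of \<open>chart_map d\<close> along \<open>X\<close>. Being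
  functions on the manifold, they may be examined in all charts, not only in \<open>d\<close> itself.\<close>

lemma smooth_vf_components:
  assumes "open U" "smooth_vf_on A U X" "d \<in> A"
  shows "smooth_fun_on A (U \<inter> chart_dom d) (\<lambda>q. vec_in A d q (X q))"
proof -
  have "smooth_vf_on A (U \<inter> chart_dom d) X"
    using assms(2) unfolding smooth_vf_on_def
    by (meson Int_lower1 Int_mono image_mono order_refl smooth_on_subset)
  then show ?thesis
    using smooth_fun_dfun[of "U \<inter> chart_dom d" X "chart_map d"] assms(1,3) chart_dom_open
      smooth_fun_subset[OF smooth_fun_chart_map[OF assms(3)]] by (simp add: vec_in_def open_Int)
qed

lemma smooth_vf_onI:
  assumes "open U" "\<And>d. d \<in> A \<Longrightarrow> smooth_fun_on A (U \<inter> chart_dom d) (\<lambda>q. vec_in A d q (X q))"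
  shows "smooth_vf_on A U X"
  unfolding smooth_vf_on_def
proof
  fix c assume c: "c \<in> A"
  show "smooth_on (chart_map c ` (chart_dom c \<inter> U)) (\<lambda>x. vec_in A c (chart_inv c x) (X (chart_inv c x)))"
    using smooth_fun_onD[OF assms(2)[OF c] c] by (simp add: Int_left_commute Int_commute)
qed

lemma smooth_vf_subset: "smooth_vf_on A U X \<Longrightarrow> W \<subseteq> U \<Longrightarrow> smooth_vf_on A W X"
  unfolding smooth_vf_on_def by (meson Int_mono image_mono order_refl smooth_on_subset)

lemma smooth_vf_cong:
  assumes "open U" "\<And>q. q \<in> U \<Longrightarrow> X q = Y q" "smooth_vf_on A U X"
  shows "smooth_vf_on A U Y"
proof (rule smooth_vf_onI[OF assms(1)])
  fix d assume d: "d \<in> A"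
  show "smooth_fun_on A (U \<inter> chart_dom d) (\<lambda>q. vec_in A d q (Y q))"
    by (rule smooth_fun_cong[OF _ _ smooth_vf_components[OF assms(1,3) d]])
       (use assms chart_dom_open[OF d] in auto)
qed

lemma smooth_vf_add:
  assumes "open U" "smooth_vf_on A U X" "smooth_vf_on A U Y"
  shows "smooth_vf_on A U (\<lambda>q. X q + Y q)"
proof (rule smooth_vf_onI[OF assms(1)])
  fix d assume d: "d \<in> A"
  have o: "open (U \<inter> chart_dom d)" using assms(1) chart_dom_open[OF d] by auto
  show "smooth_fun_on A (U \<inter> chart_dom d) (\<lambda>q. vec_in A d q (X q + Y q))"
    by (rule smooth_fun_cong[OF o _ smooth_fun_add[OF o smooth_vf_components[OF assms(1,2) d] smooth_vf_components[OF assms(1,3) d]]])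
       (use vec_in_linear[OF d] in \<open>auto simp: linear_add\<close>)
qed

lemma smooth_vf_scaleR:
  assumes "open U" "smooth_fun_on A U s" "smooth_vf_on A U X"
  shows "smooth_vf_on A U (\<lambda>q. s q *\<^sub>R X q)"
proof (rule smooth_vf_onI[OF assms(1)])
  fix d assume d: "d \<in> A"
  have o: "open (U \<inter> chart_dom d)" using assms(1) chart_dom_open[OF d] by auto
  have s: "smooth_fun_on A (U \<inter> chart_dom d) s" using smooth_fun_subset assms(2) by blast
  show "smooth_fun_on A (U \<inter> chart_dom d) (\<lambda>q. vec_in A d q (s q *\<^sub>R X q))"
    by (rule smooth_fun_cong[OF o _ smooth_fun_scaleR[OF o s smooth_vf_components[OF assms(1,3) d]]])
       (use vec_in_linear[OF d] in \<open>auto simp: linear_cmul\<close>)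
qed

lemma smooth_vf_zero: "open U \<Longrightarrow> smooth_vf_on A U (\<lambda>q. 0)"
proof (rule smooth_vf_onI)
  fix d assume U: "open U" and d: "d \<in> A"
  then have o: "open (U \<inter> chart_dom d)" using chart_dom_open[OF d] by auto
  show "smooth_fun_on A (U \<inter> chart_dom d) (\<lambda>q. vec_in A d q 0)"
    by (rule smooth_fun_cong[OF o _ smooth_fun_const[of _ 0]])
       (use vec_in_linear[OF d] in \<open>auto simp: linear_0\<close>)
qed

lemma smooth_vf_sum:
  "open U \<Longrightarrow> (\<And>i. i \<in> I \<Longrightarrow> smooth_vf_on A U (X i)) \<Longrightarrow> smooth_vf_on A U (\<lambda>q. \<Sum>i\<in>I. X i q)"
  by (induction I rule: infinite_finite_induct) (auto intro: smooth_vf_zero smooth_vf_add)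

lemma smooth_vf_local:
  assumes "open U" "\<And>p. p \<in> U \<Longrightarrow> \<exists>W. open W \<and> p \<in> W \<and> smooth_vf_on A W X"
  shows "smooth_vf_on A U X"
proof (rule smooth_vf_onI[OF assms(1)], rule smooth_fun_local)
  fix d p assume d: "d \<in> A" and p: "p \<in> U \<inter> chart_dom d"
  then obtain W where "open W" "p \<in> W" "smooth_vf_on A W X" using assms(2) by blast
  then show "\<exists>W. open W \<and> p \<in> W \<and> smooth_fun_on A W (\<lambda>q. vec_in A d q (X q))"
    using smooth_vf_components[OF _ _ d] chart_dom_open[OF d] p
    by (intro exI[of _ "W \<inter> chart_dom d"]) auto
qed

text \<open>The components in another chart arise from those in \<open>d\<close> by the derivative of the transition map,
  which is smooth.\<close>

lemma smooth_vf_chartI: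
  assumes "d \<in> A" "open U" "U \<subseteq> chart_dom d" "smooth_fun_on A U (\<lambda>q. vec_in A d q (X q))"
  shows "smooth_vf_on A U X"
proof (rule smooth_vf_onI[OF assms(2)])
  fix c assume c: "c \<in> A"
  let ?W = "U \<inter> chart_dom c"
  have o: "open ?W" using assms(2) chart_dom_open[OF c] by auto
  let ?G = "\<lambda>x. frechet_derivative (\<lambda>x. chart_map c (chart_inv d x)) (at x)"
  show "smooth_fun_on A ?W (\<lambda>q. vec_in A c q (X q))"
  proof (rule smooth_fun_cong[OF o])
    have sub: "chart_map d ` ?W \<subseteq> chart_map d ` (chart_dom d \<inter> chart_dom c)"
      using assms(3) by blast
    have sub': "?W \<subseteq> chart_dom d" using assms(3) by blast
    have G: "smooth_fun_on A ?W (\<lambda>q. ?G (chart_map d q) i)" for i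
      by (rule smooth_fun_chart_compose[OF assms(1) o sub'
            smooth_on_derivative[OF smooth_on_subset[OF transition_smooth[OF assms(1) c] sub]]])
    have X: "smooth_fun_on A ?W (\<lambda>q. vec_in A d q (X q))"
      by (rule smooth_fun_subset[OF assms(4)]) simp
    show "smooth_fun_on A ?W (\<lambda>q. \<Sum>i\<in>Basis. (vec_in A d q (X q) \<bullet> i) *\<^sub>R ?G (chart_map d q) i)"
      by (intro smooth_fun_sum[OF o] smooth_fun_scaleR[OF o] smooth_fun_inner_left[OF o] G X)
    fix q assume "q \<in> ?W"
    then have q: "q \<in> chart_dom d" "q \<in> chart_dom c" using assms(3) by auto
    have lin: "linear (?G (chart_map d q))"
      by (rule linear_frechet_derivative
          [OF smooth_fun_differentiable[OF chart_dom_open[OF c] q(2) smooth_fun_chart_map[OF c] assms(1) q(1)]])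
    have "vec_in A c q (X q) = ?G (chart_map d q) (vec_in A d q (X q))"
      unfolding vec_in_def[of A c]
      by (rule dfun_chart[OF chart_dom_open[OF c] q(2) smooth_fun_chart_map[OF c] assms(1) q(1)])
    then show "(\<Sum>i\<in>Basis. (vec_in A d q (X q) \<bullet> i) *\<^sub>R ?G (chart_map d q) i) = vec_in A c q (X q)"
      using linear_euclidean_expansion[OF lin, of "vec_in A d q (X q)"] by (rule trans[THEN sym])
  qed
qed

lemma smooth_vf_coord_vec:
  assumes "d \<in> A" shows "smooth_vf_on A (chart_dom d) (\<lambda>q. coord_vec A d q v)"
proof (rule smooth_vf_chartI[OF assms chart_dom_open[OF assms] order_refl])
  show "smooth_fun_on A (chart_dom d) (\<lambda>q. vec_in A d q (coord_vec A d q v))"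
    by (rule smooth_fun_cong[OF chart_dom_open[OF assms] _ smooth_fun_const[of _ v]])
       (simp add: vec_in_coord_vec assms)
qed

lemma smooth_fun_pair_open:
  assumes "open U" "open W" "U \<union> W = UNIV" "smooth_fun_on A U s" "smooth_fun_on A W s"
  shows "smooth_fun_on A UNIV s"
  using assms by (intro smooth_fun_local) blast

text \<open>A bump function in the chart, extended by \<open>0\<close>. The extension is smooth because the support lies in
  the preimage \<open>K\<close> of a closed ball, which is compact and therefore closed. The products with
  coordinate fields are global fields although \<open>coord_vec\<close> has no meaning off the chart domain.\<close>

lemma ex_bump:
  assumes c: "c \<in> A" and p: "p \<in> chart_dom c"
  shows "\<exists>s :: 'm \<Rightarrow> real. s p = 1 \<and> smooth_fun_on A UNIV s \<and>
    (\<forall>v. vector_field A (\<lambda>q. s q *\<^sub>R coord_vec A c q v))"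
proof -
  have "open (chart_map c ` chart_dom c)" using chart_map_image_open[OF c open_UNIV] by simp
  then obtain r where r: "r > 0" "cball (chart_map c p) r \<subseteq> chart_map c ` chart_dom c"
    using p open_contains_cball by blast
  obtain \<psi> :: "'a \<Rightarrow> real" where \<psi>: "smooth_on UNIV \<psi>" "\<psi> (chart_map c p) = 1"
    "\<And>x. x \<notin> cball (chart_map c p) r \<Longrightarrow> \<psi> x = 0"
    using ex_smooth_bump[OF r(1)] by blast
  define s where "s q = (if q \<in> chart_dom c then \<psi> (chart_map c q) else 0)" for q
  define K where "K = chart_inv c ` cball (chart_map c p) r"
  have "continuous_on (cball (chart_map c p) r) (chart_inv c)"
    using homeomorphism_cont2[OF chart_homeo[OF c]] continuous_on_subset r(2) by blast
  then have "compact K" unfolding K_def by (intro compact_continuous_image compact_cball)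
  then have oK: "open (- K)" using compact_imp_closed by blast
  have s0: "s q = 0" if "q \<in> - K" for q
  proof (cases "q \<in> chart_dom c")
    case True
    then have "chart_map c q \<notin> cball (chart_map c p) r"
      using that chart_inv_map[OF c] unfolding K_def by force
    then show ?thesis by (simp add: s_def \<psi>)
  qed (simp add: s_def)
  have "K \<subseteq> chart_dom c"
    unfolding K_def using r(2) chart_inv_map[OF c] by force
  then have cover: "chart_dom c \<union> - K = UNIV" by auto
  have sc: "smooth_fun_on A (chart_dom c) s"
    by (rule smooth_fun_cong[OF chart_dom_open[OF c] _ smooth_fun_chart_compose[OF c chart_dom_open[OF c] order_refl smooth_on_subset[OF \<psi>(1)]]])
       (auto simp: s_def)
  have sK: "smooth_fun_on A (- K) s"
    by (rule smooth_fun_cong[OF oK _ smooth_fun_const[of _ 0]]) (simp add: s0)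
  have "smooth_fun_on A UNIV s"
    using smooth_fun_pair_open[OF chart_dom_open[OF c] oK cover sc sK] .
  moreover have "vector_field A (\<lambda>q. s q *\<^sub>R coord_vec A c q v)" for v
  proof -
    have "smooth_vf_on A (chart_dom c) (\<lambda>q. s q *\<^sub>R coord_vec A c q v)"
      by (rule smooth_vf_scaleR[OF chart_dom_open[OF c] sc smooth_vf_coord_vec[OF c]])
    moreover have "smooth_vf_on A (- K) (\<lambda>q. s q *\<^sub>R coord_vec A c q v)"
      by (rule smooth_vf_cong[OF oK _ smooth_vf_zero[OF oK]]) (simp add: s0)
    ultimately show ?thesis
      using cover chart_dom_open[OF c] oK by (intro smooth_vf_local) blast+
  qed
  moreover have "s p = 1" using p \<psi>(2) by (simp add: s_def)
  ultimately show ?thesis by blast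
qed

lemma ex_vector_field: "\<exists>X. vector_field A X \<and> X p = u"
proof -
  obtain s :: "'m \<Rightarrow> real" where s: "s p = 1"
    "\<And>v. vector_field A (\<lambda>q. s q *\<^sub>R coord_vec A (chart_at A p) q v)"
    using ex_bump[OF chart_at_mem chart_at_dom] by blast
  show ?thesis
    using s coord_vec_vec_in[OF chart_at_mem chart_at_dom]
    by (intro exI[of _ "\<lambda>q. s q *\<^sub>R coord_vec A (chart_at A p) q (vec_in A (chart_at A p) p u)"]) auto
qed

end

section \<open>Affine connections\<close>

locale affine_manifold = smooth_manifold A
  for A :: "('m::{t2_space, second_countable_topology}, 'a::euclidean_space) atlas" +
  fixes nab :: "('m, 'a) connection"
  assumes affine: "affine_connection A nab"
begin

lemmas affine_open = affine[unfolded affine_connection_def, THEN spec, THEN mp]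

lemma nab_linear:
  assumes "open U" "p \<in> U" "smooth_vf_on A U Y"
  shows "linear (\<lambda>u. nab p u Y)"
  using affine_open[OF assms(1), THEN conjunct1, rule_format, OF assms(3,2)] .

lemma nab_add:
  assumes "open U" "p \<in> U" "smooth_vf_on A U Y" "smooth_vf_on A U Z"
  shows "nab p u (\<lambda>q. Y q + Z q) = nab p u Y + nab p u Z"
  using affine_open[OF assms(1), THEN conjunct2, THEN conjunct1, rule_format, OF assms(3,4,2)] .

lemma nab_scaleR:
  assumes "open U" "p \<in> U" "smooth_fun_on A U s" "smooth_vf_on A U Y"
  shows "nab p u (\<lambda>q. s q *\<^sub>R Y q) = dfun A s p u *\<^sub>R Y p + s p *\<^sub>R nab p u Y"
  using affine_open[OF assms(1), THEN conjunct2, THEN conjunct2, THEN conjunct1, rule_format, OF assms(3,4,2)] .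

lemma nab_smooth:
  assumes "open U" "smooth_vf_on A U X" "smooth_vf_on A U Y"
  shows "smooth_vf_on A U (\<lambda>p. nab p (X p) Y)"
  using affine_open[OF assms(1), THEN conjunct2, THEN conjunct2, THEN conjunct2, rule_format, OF assms(2,3)] .

text \<open>A connection depends on germs only. The Leibniz rule is applied to the indicator function of \<open>U\<close>,
  which is constant on \<open>U\<close> and so is admissible there, and which makes the products with \<open>Y\<close> and \<open>Z\<close>
  equal as functions.\<close>

lemma nab_cong:
  assumes "open U" "p \<in> U" "smooth_vf_on A U Y" "\<And>q. q \<in> U \<Longrightarrow> Y q = Z q"
  shows "nab p u Y = nab p u Z"
proof -
  define \<rho> :: "'m \<Rightarrow> real" where "\<rho> q = (if q \<in> U then 1 else 0)" for q
  have \<rho>: "smooth_fun_on A U \<rho>"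
    by (rule smooth_fun_cong[OF assms(1) _ smooth_fun_const[of _ 1]]) (simp add: \<rho>_def)
  have d: "dfun A \<rho> p u = 0"
    using dfun_cong[OF assms(1,2), of \<rho> "\<lambda>q. 1"] dfun_const[of 1] by (simp add: \<rho>_def)
  have Z: "smooth_vf_on A U Z" by (rule smooth_vf_cong[OF assms(1,4,3)])
  have "(\<lambda>q. \<rho> q *\<^sub>R Y q) = (\<lambda>q. \<rho> q *\<^sub>R Z q)" by (auto simp: \<rho>_def assms(4))
  moreover have "nab p u (\<lambda>q. \<rho> q *\<^sub>R Y q) = nab p u Y"
    using nab_scaleR[OF assms(1,2) \<rho> assms(3)] d assms(2) by (simp add: \<rho>_def)
  moreover have "nab p u (\<lambda>q. \<rho> q *\<^sub>R Z q) = nab p u Z"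
    using nab_scaleR[OF assms(1,2) \<rho> Z] d assms(2) by (simp add: \<rho>_def)
  ultimately show ?thesis by simp
qed

lemma nab_zero: "nab p u (\<lambda>q. 0) = 0"
  using nab_add[OF open_UNIV _ smooth_vf_zero smooth_vf_zero, of p u] by simp

lemma nab_sum:
  assumes "open U" "p \<in> U" "\<And>i. i \<in> I \<Longrightarrow> smooth_vf_on A U (Y i)"
  shows "nab p u (\<lambda>q. \<Sum>i\<in>I. Y i q) = (\<Sum>i\<in>I. nab p u (Y i))"
  using assms(3)
  by (induction I rule: infinite_finite_induct)
     (simp_all add: nab_zero nab_add[OF assms(1,2)] smooth_vf_sum[OF assms(1)])

end

section \<open>Smooth maps and fields along them\<close>

locale smooth_map_between = M: smooth_manifold A + N: smooth_manifold B
  for A :: "('m::{t2_space, second_countable_topology}, 'a::euclidean_space) atlas"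
    and B :: "('n::{t2_space, second_countable_topology}, 'b::euclidean_space) atlas" +
  fixes f :: "'m \<Rightarrow> 'n"
  assumes smooth: "smooth_map A B f"
begin

lemma open_preimage: "open V \<Longrightarrow> open (f -` V)"
  using smooth unfolding smooth_map_def by (simp add: continuous_on_open_vimage)

lemma smooth_fun_chart_map_f:
  "d \<in> B \<Longrightarrow> smooth_fun_on A (f -` chart_dom d) (\<lambda>q. chart_map d (f q))"
  using smooth unfolding smooth_map_def smooth_fun_on_def comp_def by blast

lemma smooth_fun_pullback:
  fixes s :: "'n \<Rightarrow> 'v::real_normed_vector"
  assumes "open V" "smooth_fun_on B V s"
  shows "smooth_fun_on A (f -` V) (\<lambda>q. s (f q))"
proof (rule M.smooth_fun_local)
  fix p assume p: "p \<in> f -` V"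
  let ?d = "chart_at B (f p)"
  let ?V = "chart_dom ?d \<inter> V"
  have V: "open ?V" "?V \<subseteq> chart_dom ?d"
    using assms(1) N.chart_dom_open[OF N.chart_at_mem] by auto
  have W: "open (f -` ?V)" by (rule open_preimage[OF V(1)])
  have t: "smooth_fun_on A (f -` ?V) (\<lambda>q. chart_map ?d (f q))"
    by (rule M.smooth_fun_subset[OF smooth_fun_chart_map_f[OF N.chart_at_mem]]) auto
  have "smooth_fun_on A (f -` ?V) (\<lambda>q. s (chart_inv ?d (chart_map ?d (f q))))"
    by (rule M.smooth_fun_compose[OF W t N.chart_map_image_open[OF N.chart_at_mem assms(1)] _
          N.smooth_fun_onD[OF assms(2) N.chart_at_mem]]) auto
  then have "smooth_fun_on A (f -` ?V) (\<lambda>q. s (f q))"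
    by (rule M.smooth_fun_cong[OF W, rotated]) (simp add: N.chart_inv_map[OF N.chart_at_mem])
  then show "\<exists>W. open W \<and> p \<in> W \<and> smooth_fun_on A W (\<lambda>q. s (f q))"
    using W p N.chart_at_dom by blast
qed

lemma dmap_eq: "dmap A B f p u = dfun A (\<lambda>q. chart_map (chart_at B (f p)) (f q)) p u"
  by (simp add: dmap_def comp_def)

lemma dmap_linear: "linear (dmap A B f p)"
  using M.dfun_linear[OF open_preimage[OF N.chart_dom_open[OF N.chart_at_mem]] _ smooth_fun_chart_map_f[OF N.chart_at_mem], of p "f p"]
    N.chart_at_dom[of "f p"] unfolding dmap_eq[abs_def] by simp

text \<open>The chain rule, with the derivative of \<open>f\<close> read off in the preferred chart at \<open>f p\<close>.\<close>

lemma dfun_dmap: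
  fixes s :: "'n \<Rightarrow> 'v::real_normed_vector"
  assumes "open V" "f p \<in> V" "smooth_fun_on B V s"
  shows "dfun B s (f p) (dmap A B f p u) = dfun A (\<lambda>q. s (f q)) p u"
proof -
  let ?d = "chart_at B (f p)"
  let ?G = "\<lambda>x. s (chart_inv ?d x)"
  have d: "?d \<in> B" "f p \<in> chart_dom ?d" by (rule N.chart_at_mem, rule N.chart_at_dom)
  have W: "open (f -` chart_dom ?d)" "p \<in> f -` chart_dom ?d"
    using open_preimage[OF N.chart_dom_open[OF d(1)]] d(2) by auto
  have "dfun A (\<lambda>q. s (f q)) p u = dfun A (\<lambda>q. ?G (chart_map ?d (f q))) p u"
    by (rule M.dfun_cong[OF W]) (simp add: N.chart_inv_map[OF d(1)])
  also have "\<dots> = frechet_derivative ?G (at (chart_map ?d (f p))) (dmap A B f p u)"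
    unfolding dmap_eq
    by (rule M.dfun_compose[OF W smooth_fun_chart_map_f[OF d(1)] N.smooth_fun_differentiable[OF assms d]])
  also have "\<dots> = dfun B s (f p) (dmap A B f p u)"
    using N.dfun_chart[OF assms d, of "dmap A B f p u"] by (simp add: N.vec_in_chart_at)
  finally show ?thesis by simp
qed

lemma vec_in_dmap:
  assumes "d \<in> B" "f p \<in> chart_dom d"
  shows "vec_in B d (f p) (dmap A B f p u) = dfun A (\<lambda>q. chart_map d (f q)) p u"
  using dfun_dmap[OF N.chart_dom_open[OF assms(1)] assms(2) N.smooth_fun_chart_map[OF assms(1)]]
  by (simp add: vec_in_def)

subsection \<open>Smooth fields along the map\<close>

text \<open>As for vector fields, the values of \<open>Y\<close> refer to the preferred chart at \<open>f q\<close>, which jumps with \<open>q\<close>;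
  smoothness is therefore a property of the components in fixed charts.\<close>

definition smooth_along :: "'m set \<Rightarrow> ('m \<Rightarrow> 'b) \<Rightarrow> bool" where
  "smooth_along U Y \<longleftrightarrow>
     (\<forall>d\<in>B. smooth_fun_on A (U \<inter> f -` chart_dom d) (\<lambda>q. vec_in B d (f q) (Y q)))"

lemma smooth_alongD:
  "smooth_along U Y \<Longrightarrow> d \<in> B \<Longrightarrow> smooth_fun_on A (U \<inter> f -` chart_dom d) (\<lambda>q. vec_in B d (f q) (Y q))"
  by (simp add: smooth_along_def)

lemma smooth_alongI:
  "(\<And>d. d \<in> B \<Longrightarrow> smooth_fun_on A (U \<inter> f -` chart_dom d) (\<lambda>q. vec_in B d (f q) (Y q))) \<Longrightarrow> smooth_along U Y"
  by (simp add: smooth_along_def)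

lemma open_Int_preimage_dom: "open U \<Longrightarrow> d \<in> B \<Longrightarrow> open (U \<inter> f -` chart_dom d)"
  using open_preimage N.chart_dom_open by (simp add: open_Int)

lemma smooth_along_subset: "smooth_along U Y \<Longrightarrow> W \<subseteq> U \<Longrightarrow> smooth_along W Y"
  unfolding smooth_along_def by (meson Int_mono M.smooth_fun_subset order_refl)

lemma smooth_along_cong:
  assumes "open U" "\<And>q. q \<in> U \<Longrightarrow> Y q = Z q" "smooth_along U Y"
  shows "smooth_along U Z"
proof (rule smooth_alongI)
  fix d assume d: "d \<in> B"
  show "smooth_fun_on A (U \<inter> f -` chart_dom d) (\<lambda>q. vec_in B d (f q) (Z q))"
    by (rule M.smooth_fun_cong[OF open_Int_preimage_dom[OF assms(1) d] _ smooth_alongD[OF assms(3) d]])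
       (simp add: assms(2))
qed

lemma smooth_along_local:
  assumes "\<And>p. p \<in> U \<Longrightarrow> \<exists>W. open W \<and> p \<in> W \<and> smooth_along W Y"
  shows "smooth_along U Y"
proof (rule smooth_alongI, rule M.smooth_fun_local)
  fix d p assume d: "d \<in> B" and p: "p \<in> U \<inter> f -` chart_dom d"
  then obtain W where "open W" "p \<in> W" "smooth_along W Y" using assms by blast
  then show "\<exists>W. open W \<and> p \<in> W \<and> smooth_fun_on A W (\<lambda>q. vec_in B d (f q) (Y q))"
    using smooth_alongD[OF _ d] open_Int_preimage_dom[OF _ d] p by blast
qed

lemma smooth_along_add:
  assumes "open U" "smooth_along U Y" "smooth_along U Z"
  shows "smooth_along U (\<lambda>q. Y q + Z q)"
proof (rule smooth_alongI)
  fix d assume d: "d \<in> B"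
  note o = open_Int_preimage_dom[OF assms(1) d]
  show "smooth_fun_on A (U \<inter> f -` chart_dom d) (\<lambda>q. vec_in B d (f q) (Y q + Z q))"
    by (rule M.smooth_fun_cong[OF o _ M.smooth_fun_add[OF o smooth_alongD[OF assms(2) d] smooth_alongD[OF assms(3) d]]])
       (simp add: linear_add[OF N.vec_in_linear[OF d]])
qed

lemma smooth_along_scaleR:
  assumes "open U" "smooth_fun_on A U s" "smooth_along U Y"
  shows "smooth_along U (\<lambda>q. s q *\<^sub>R Y q)"
proof (rule smooth_alongI)
  fix d assume d: "d \<in> B"
  note o = open_Int_preimage_dom[OF assms(1) d]
  have s: "smooth_fun_on A (U \<inter> f -` chart_dom d) s" by (rule M.smooth_fun_subset[OF assms(2)]) simp
  show "smooth_fun_on A (U \<inter> f -` chart_dom d) (\<lambda>q. vec_in B d (f q) (s q *\<^sub>R Y q))"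
    by (rule M.smooth_fun_cong[OF o _ M.smooth_fun_scaleR[OF o s smooth_alongD[OF assms(3) d]]])
       (simp add: linear_cmul[OF N.vec_in_linear[OF d]])
qed

lemma smooth_along_zero:
  assumes "open U" shows "smooth_along U (\<lambda>q. 0)"
proof (rule smooth_alongI)
  fix d assume d: "d \<in> B"
  show "smooth_fun_on A (U \<inter> f -` chart_dom d) (\<lambda>q. vec_in B d (f q) 0)"
    by (rule M.smooth_fun_cong[OF open_Int_preimage_dom[OF assms d] _ M.smooth_fun_const[of _ 0]])
       (simp add: linear_0[OF N.vec_in_linear[OF d]])
qed

lemma smooth_along_sum:
  "open U \<Longrightarrow> (\<And>i. i \<in> I \<Longrightarrow> smooth_along U (Y i)) \<Longrightarrow> smooth_along U (\<lambda>q. \<Sum>i\<in>I. Y i q)"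
  by (induction I rule: infinite_finite_induct) (simp_all add: smooth_along_zero smooth_along_add)

lemma smooth_along_diff:
  assumes "open U" "smooth_along U Y" "smooth_along U Z"
  shows "smooth_along U (\<lambda>q. Y q - Z q)"
  using smooth_along_add[OF assms(1,2) smooth_along_scaleR[OF assms(1) M.smooth_fun_const[of _ "-1"] assms(3)]]
  by simp

lemma smooth_along_pullback:
  assumes "open V" "smooth_vf_on B V Z"
  shows "smooth_along (f -` V) (\<lambda>q. Z (f q))"
proof (rule smooth_alongI)
  fix d assume d: "d \<in> B"
  have "open (V \<inter> chart_dom d)" using assms(1) N.chart_dom_open[OF d] by auto
  from smooth_fun_pullback[OF this N.smooth_vf_components[OF assms d]]
  show "smooth_fun_on A (f -` V \<inter> f -` chart_dom d) (\<lambda>q. vec_in B d (f q) (Z (f q)))"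
    by simp
qed

lemma smooth_along_dmap:
  assumes "open U" "smooth_vf_on A U X"
  shows "smooth_along U (\<lambda>q. dmap A B f q (X q))"
proof (rule smooth_alongI)
  fix d assume d: "d \<in> B"
  let ?W = "U \<inter> f -` chart_dom d"
  note o = open_Int_preimage_dom[OF assms(1) d]
  have t: "smooth_fun_on A ?W (\<lambda>q. chart_map d (f q))"
    by (rule M.smooth_fun_subset[OF smooth_fun_chart_map_f[OF d]]) simp
  have X: "smooth_vf_on A ?W X" by (rule M.smooth_vf_subset[OF assms(2)]) simp
  show "smooth_fun_on A ?W (\<lambda>q. vec_in B d (f q) (dmap A B f q (X q)))"
    by (rule M.smooth_fun_cong[OF o _ M.smooth_fun_dfun[OF o X t]]) (simp add: vec_in_dmap[OF d])
qed

end

section \<open>The pulled back connection\<close>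

locale connection_along = smooth_map_between A B f + N: affine_manifold B nab
  for A :: "('m::{t2_space, second_countable_topology}, 'a::euclidean_space) atlas"
    and B :: "('n::{t2_space, second_countable_topology}, 'b::euclidean_space) atlas"
    and f :: "'m \<Rightarrow> 'n" and nab :: "('n, 'b) connection"
begin

abbreviation cov :: "'m \<Rightarrow> 'a \<Rightarrow> ('m \<Rightarrow> 'b) \<Rightarrow> 'b" where
  "cov \<equiv> cov_along A B nab f"

lemma cov_eq:
  "cov p u Y = (\<Sum>i\<in>Basis.
     dfun A (\<lambda>q. vec_in B (chart_at B (f p)) (f q) (Y q) \<bullet> i) p u *\<^sub>R coord_vec B (chart_at B (f p)) (f p) i +
     (vec_in B (chart_at B (f p)) (f p) (Y p) \<bullet> i) *\<^sub>R
       nab (f p) (dmap A B f p u) (\<lambda>r. coord_vec B (chart_at B (f p)) r i))"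
  by (simp add: cov_along_def Let_def)

lemma nbhd_chart_at:
  assumes "open U" "p \<in> U"
  shows "open (U \<inter> f -` chart_dom (chart_at B (f p)))" "p \<in> U \<inter> f -` chart_dom (chart_at B (f p))"
  using open_Int_preimage_dom[OF assms(1) N.chart_at_mem] assms N.chart_at_dom by auto

lemma smooth_component:
  "open U \<Longrightarrow> smooth_along U Y \<Longrightarrow> d \<in> B \<Longrightarrow>
    smooth_fun_on A (U \<inter> f -` chart_dom d) (\<lambda>q. vec_in B d (f q) (Y q) \<bullet> i)"
  by (rule M.smooth_fun_inner_left[OF open_Int_preimage_dom smooth_alongD])

text \<open>The next lemmas characterise the pulled back connection: it depends on germs, is additive, obeys the
  Leibniz rule and restricts to \<open>nab\<close> on fields of the ambient manifold. Later arguments use these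
  properties instead of the coordinate definition.\<close>

lemma cov_cong:
  assumes "open U" "p \<in> U" "\<And>q. q \<in> U \<Longrightarrow> Y q = Z q"
  shows "cov p u Y = cov p u Z"
proof -
  have "dfun A (\<lambda>q. vec_in B (chart_at B (f p)) (f q) (Y q) \<bullet> i) p u =
        dfun A (\<lambda>q. vec_in B (chart_at B (f p)) (f q) (Z q) \<bullet> i) p u" for i
    by (rule M.dfun_cong[OF assms(1,2)]) (simp add: assms(3))
  then show ?thesis by (simp add: cov_eq assms)
qed

lemma cov_add:
  assumes "open U" "p \<in> U" "smooth_along U Y" "smooth_along U Z"
  shows "cov p u (\<lambda>q. Y q + Z q) = cov p u Y + cov p u Z"
proof -
  let ?d = "chart_at B (f p)"
  note W = nbhd_chart_at[OF assms(1,2)]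
  have lin: "linear (vec_in B ?d (f q))" if "f q \<in> chart_dom ?d" for q
    using N.vec_in_linear[OF N.chart_at_mem that] .
  have "dfun A (\<lambda>q. vec_in B ?d (f q) (Y q + Z q) \<bullet> i) p u =
        dfun A (\<lambda>q. vec_in B ?d (f q) (Y q) \<bullet> i + vec_in B ?d (f q) (Z q) \<bullet> i) p u" for i
    by (rule M.dfun_cong[OF W]) (simp add: linear_add[OF lin] inner_add_left)
  then have "dfun A (\<lambda>q. vec_in B ?d (f q) (Y q + Z q) \<bullet> i) p u =
        dfun A (\<lambda>q. vec_in B ?d (f q) (Y q) \<bullet> i) p u + dfun A (\<lambda>q. vec_in B ?d (f q) (Z q) \<bullet> i) p u" for i
    by (simp add: M.dfun_add[OF W smooth_component[OF assms(1,3) N.chart_at_mem] smooth_component[OF assms(1,4) N.chart_at_mem]])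
  then show ?thesis
    unfolding cov_eq linear_add[OF lin[OF N.chart_at_dom]]
    by (simp add: inner_add_left algebra_simps sum.distrib)
qed

lemma cov_scaleR:
  assumes "open U" "p \<in> U" "smooth_fun_on A U s" "smooth_along U Y"
  shows "cov p u (\<lambda>q. s q *\<^sub>R Y q) = dfun A s p u *\<^sub>R Y p + s p *\<^sub>R cov p u Y"
proof -
  let ?d = "chart_at B (f p)"
  note W = nbhd_chart_at[OF assms(1,2)]
  have lin: "linear (vec_in B ?d (f q))" if "f q \<in> chart_dom ?d" for q
    using N.vec_in_linear[OF N.chart_at_mem that] .
  have s: "smooth_fun_on A (U \<inter> f -` chart_dom ?d) s" by (rule M.smooth_fun_subset[OF assms(3)]) simp
  have "dfun A (\<lambda>q. vec_in B ?d (f q) (s q *\<^sub>R Y q) \<bullet> i) p u =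
        dfun A (\<lambda>q. s q * (vec_in B ?d (f q) (Y q) \<bullet> i)) p u" for i
    by (rule M.dfun_cong[OF W]) (simp add: linear_cmul[OF lin])
  then have D: "dfun A (\<lambda>q. vec_in B ?d (f q) (s q *\<^sub>R Y q) \<bullet> i) p u =
        s p * dfun A (\<lambda>q. vec_in B ?d (f q) (Y q) \<bullet> i) p u + dfun A s p u * (vec_in B ?d (f p) (Y p) \<bullet> i)" for i
    by (simp add: M.dfun_mult[OF W s smooth_component[OF assms(1,4) N.chart_at_mem]])
  have Y: "Y p = (\<Sum>i\<in>Basis. (vec_in B ?d (f p) (Y p) \<bullet> i) *\<^sub>R coord_vec B ?d (f p) i)"
    by (rule N.coord_vec_expansion[OF N.chart_at_mem N.chart_at_dom])
  have "dfun A s p u *\<^sub>R Y p + s p *\<^sub>R cov p u Y =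
    dfun A s p u *\<^sub>R (\<Sum>i\<in>Basis. (vec_in B ?d (f p) (Y p) \<bullet> i) *\<^sub>R coord_vec B ?d (f p) i) + s p *\<^sub>R cov p u Y"
    using Y by simp
  also have "\<dots> = cov p u (\<lambda>q. s q *\<^sub>R Y q)"
    unfolding cov_eq D linear_cmul[OF lin[OF N.chart_at_dom]] scaleR_sum_right sum.distrib[symmetric]
    by (rule sum.cong) (simp_all add: algebra_simps)
  finally show ?thesis by simp
qed

lemma cov_zero: "cov p u (\<lambda>q. 0) = 0"
  using cov_add[OF open_UNIV _ smooth_along_zero smooth_along_zero, of p u] by simp

lemma cov_sum:
  assumes "open U" "p \<in> U" "\<And>i. i \<in> I \<Longrightarrow> smooth_along U (Y i)"
  shows "cov p u (\<lambda>q. \<Sum>i\<in>I. Y i q) = (\<Sum>i\<in>I. cov p u (Y i))"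
  using assms(3)
  by (induction I rule: infinite_finite_induct)
     (simp_all add: cov_zero cov_add[OF assms(1,2)] smooth_along_sum[OF assms(1)])

lemma cov_linear:
  assumes "open U" "p \<in> U" "smooth_along U Y"
  shows "linear (\<lambda>u. cov p u Y)"
proof -
  let ?d = "chart_at B (f p)"
  note W = nbhd_chart_at[OF assms(1,2)]
  have 1: "linear (dfun A (\<lambda>q. vec_in B ?d (f q) (Y q) \<bullet> i) p)" for i
    by (rule M.dfun_linear[OF W smooth_component[OF assms(1,3) N.chart_at_mem]])
  have 2: "linear (\<lambda>w. nab (f p) w (\<lambda>r. coord_vec B ?d r i))" for i
    by (rule N.nab_linear[OF N.chart_dom_open[OF N.chart_at_mem] N.chart_at_dom N.smooth_vf_coord_vec[OF N.chart_at_mem]])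
  show ?thesis unfolding cov_eq
    by (rule linearI)
       (simp_all add: linear_add[OF 1] linear_cmul[OF 1] linear_add[OF dmap_linear] linear_cmul[OF dmap_linear]
          linear_add[OF 2] linear_cmul[OF 2] algebra_simps sum.distrib scaleR_sum_right)
qed

text \<open>\<open>Z\<close> is a combination of the coordinate fields with the functions \<open>?z i\<close> as coefficients; expanding
  \<open>nab Z\<close> by the Leibniz rule gives the defining formula, because differentiating a coefficient along
  \<open>df u\<close> is differentiating its pullback along \<open>u\<close>.\<close>

lemma cov_pullback:
  assumes "open V" "f p \<in> V" "smooth_vf_on B V Z"
  shows "cov p u (\<lambda>q. Z (f q)) = nab (f p) (dmap A B f p u) Z"
proof -
  let ?d = "chart_at B (f p)"
  let ?V = "V \<inter> chart_dom ?d"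
  let ?z = "\<lambda>i r. vec_in B ?d r (Z r) \<bullet> i" and ?E = "\<lambda>i r. coord_vec B ?d r i"
  have V: "open ?V" "f p \<in> ?V"
    using assms(1,2) N.chart_dom_open[OF N.chart_at_mem] N.chart_at_dom by auto
  have z: "smooth_fun_on B ?V (?z i)" for i
    by (rule N.smooth_fun_inner_left[OF V(1) N.smooth_vf_components[OF assms(1,3) N.chart_at_mem]])
  have E: "smooth_vf_on B ?V (?E i)" for i
    by (rule N.smooth_vf_subset[OF N.smooth_vf_coord_vec[OF N.chart_at_mem]]) simp
  have "smooth_vf_on B ?V Z" by (rule N.smooth_vf_subset[OF assms(3)]) simp
  then have "nab (f p) w Z = nab (f p) w (\<lambda>r. \<Sum>i\<in>Basis. ?z i r *\<^sub>R ?E i r)" for w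
    by (rule N.nab_cong[OF V]) (rule N.coord_vec_expansion[OF N.chart_at_mem], simp)
  then have "nab (f p) w Z = (\<Sum>i\<in>Basis. dfun B (?z i) (f p) w *\<^sub>R ?E i (f p) + ?z i (f p) *\<^sub>R nab (f p) w (?E i))" for w
    by (simp add: N.nab_sum[OF V N.smooth_vf_scaleR[OF V(1) z E]] N.nab_scaleR[OF V z E])
  then show ?thesis by (simp add: cov_eq dfun_dmap[OF V z])
qed

text \<open>The defining formula holds in every chart around \<open>f p\<close>, not only in the preferred one: expand \<open>Y\<close> in
  coordinate fields of \<open>d\<close> and use the characteristic properties. In a neighbourhood of a point one
  chart can thus be kept fixed.\<close>

lemma cov_in_chart:
  assumes "open U" "p \<in> U" "smooth_along U Y" "d \<in> B" "f p \<in> chart_dom d"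
  shows "cov p u Y = (\<Sum>i\<in>Basis.
     dfun A (\<lambda>q. vec_in B d (f q) (Y q) \<bullet> i) p u *\<^sub>R coord_vec B d (f p) i +
     (vec_in B d (f p) (Y p) \<bullet> i) *\<^sub>R nab (f p) (dmap A B f p u) (\<lambda>r. coord_vec B d r i))"
proof -
  let ?W = "U \<inter> f -` chart_dom d"
  let ?y = "\<lambda>i q. vec_in B d (f q) (Y q) \<bullet> i" and ?E = "\<lambda>i q. coord_vec B d (f q) i"
  have W: "open ?W" "p \<in> ?W" using open_Int_preimage_dom[OF assms(1,4)] assms by auto
  have y: "smooth_fun_on A ?W (?y i)" for i by (rule smooth_component[OF assms(1,3,4)])
  note vf = N.chart_dom_open[OF assms(4)] N.smooth_vf_coord_vec[OF assms(4)]
  have E: "smooth_along ?W (?E i)" for i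
    by (rule smooth_along_subset[OF smooth_along_pullback[OF vf]]) simp
  have "cov p u Y = cov p u (\<lambda>q. \<Sum>i\<in>Basis. ?y i q *\<^sub>R ?E i q)"
    by (rule cov_cong[OF W]) (rule N.coord_vec_expansion[OF assms(4)], simp)
  also have "\<dots> = (\<Sum>i\<in>Basis. dfun A (?y i) p u *\<^sub>R ?E i p + ?y i p *\<^sub>R cov p u (?E i))"
    by (simp add: cov_sum[OF W smooth_along_scaleR[OF W(1) y E]] cov_scaleR[OF W y E])
  finally show ?thesis
    by (simp add: cov_pullback[OF vf(1) assms(5) vf(2)])
qed

text \<open>Near a point, \<open>cov_in_chart\<close> with a fixed chart expresses the derivative by smooth components, their
  derivatives, and the ambient fields \<open>nab E\<^sub>j E\<^sub>i\<close> pulled back along \<open>f\<close>.\<close>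

lemma cov_smooth:
  assumes "open U" "smooth_vf_on A U X" "smooth_along U Y"
  shows "smooth_along U (\<lambda>q. cov q (X q) Y)"
proof (rule smooth_along_local)
  fix p assume p: "p \<in> U"
  let ?d = "chart_at B (f p)"
  let ?W = "U \<inter> f -` chart_dom ?d"
  note d = N.chart_at_mem[of "f p"]
  note W = nbhd_chart_at[OF assms(1) p]
  note vf = N.chart_dom_open[OF d] N.smooth_vf_coord_vec[OF d]
  let ?y = "\<lambda>i q. vec_in B ?d (f q) (Y q) \<bullet> i" and ?E = "\<lambda>i r. coord_vec B ?d r i"
  let ?x = "\<lambda>j q. vec_in B ?d (f q) (dmap A B f q (X q)) \<bullet> j"
  have X: "smooth_vf_on A ?W X" by (rule M.smooth_vf_subset[OF assms(2)]) simp
  have y: "smooth_fun_on A ?W (?y i)" for i by (rule smooth_component[OF assms(1,3) d])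
  have x: "smooth_fun_on A ?W (?x j)" for j
    by (rule smooth_component[OF assms(1) smooth_along_dmap[OF assms(1,2)] d])
  have E: "smooth_along ?W (\<lambda>q. ?E i (f q))" for i
    by (rule smooth_along_subset[OF smooth_along_pullback[OF vf]]) simp
  have G: "smooth_along ?W (\<lambda>q. nab (f q) (?E j (f q)) (?E i))" for i j
    by (rule smooth_along_subset[OF smooth_along_pullback[OF vf(1) N.nab_smooth[OF vf vf(2)]]]) simp
  have "smooth_along ?W (\<lambda>q. \<Sum>i\<in>Basis. dfun A (?y i) q (X q) *\<^sub>R ?E i (f q) +
      ?y i q *\<^sub>R (\<Sum>j\<in>Basis. ?x j q *\<^sub>R nab (f q) (?E j (f q)) (?E i)))"
    by (intro smooth_along_sum[OF W(1)] smooth_along_add[OF W(1)] smooth_along_scaleR[OF W(1)]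
        M.smooth_fun_dfun[OF W(1) X] y E x G)
  then have "smooth_along ?W (\<lambda>q. cov q (X q) Y)"
  proof (rule smooth_along_cong[OF W(1), rotated])
    fix q assume "q \<in> ?W"
    then have q: "q \<in> U" "f q \<in> chart_dom ?d" by auto
    have "nab (f q) (dmap A B f q (X q)) (?E i) = (\<Sum>j\<in>Basis. ?x j q *\<^sub>R nab (f q) (?E j (f q)) (?E i))" for i
    proof -
      note lin = N.nab_linear[OF vf(1) q(2) vf(2)]
      have "nab (f q) (dmap A B f q (X q)) (?E i) =
         nab (f q) (\<Sum>j\<in>Basis. ?x j q *\<^sub>R ?E j (f q)) (?E i)"
        using N.coord_vec_expansion[OF d q(2), of "dmap A B f q (X q)"] by simp
      also have "\<dots> = (\<Sum>j\<in>Basis. ?x j q *\<^sub>R nab (f q) (?E j (f q)) (?E i))"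
        by (simp add: linear_sum[OF lin] linear_cmul[OF lin])
      finally show ?thesis .
    qed
    then show "(\<Sum>i\<in>Basis. dfun A (?y i) q (X q) *\<^sub>R ?E i (f q) +
      ?y i q *\<^sub>R (\<Sum>j\<in>Basis. ?x j q *\<^sub>R nab (f q) (?E j (f q)) (?E i))) = cov q (X q) Y"
      by (simp add: cov_in_chart[OF assms(1) q(1) assms(3) d q(2)])
  qed
  with W show "\<exists>W. open W \<and> p \<in> W \<and> smooth_along W (\<lambda>q. cov q (X q) Y)" by blast
qed

end

section \<open>Compatibility with the metric\<close>

locale metric_along = connection_along A B f nab
  for A :: "('m::{t2_space, second_countable_topology}, 'a::euclidean_space) atlas"
    and B :: "('n::{t2_space, second_countable_topology}, 'b::euclidean_space) atlas"
    and f :: "'m \<Rightarrow> 'n" and nab :: "('n, 'b) connection" +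
  fixes g :: "'n \<Rightarrow> 'b \<Rightarrow> 'b \<Rightarrow> real"
  assumes metric: "riemannian_metric B g" and levi_civita: "levi_civita B g nab"
begin

lemma g_bilinear: "bilinear (g r)" and g_sym: "g r u v = g r v u"
  and g_pos: "u \<noteq> 0 \<Longrightarrow> g r u u > 0"
  using metric unfolding riemannian_metric_def by auto

lemmas g_simps = bilinear_ladd[OF g_bilinear] bilinear_radd[OF g_bilinear]
  bilinear_lmul[OF g_bilinear] bilinear_rmul[OF g_bilinear]
  bilinear_lsub[OF g_bilinear] bilinear_rsub[OF g_bilinear]
  bilinear_lzero[OF g_bilinear] bilinear_rzero[OF g_bilinear]
  bilinear_lneg[OF g_bilinear] bilinear_rneg[OF g_bilinear]

lemma g_sum_left: "g r (\<Sum>i\<in>I. u i) v = (\<Sum>i\<in>I. g r (u i) v)"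
  by (induction I rule: infinite_finite_induct) (simp_all add: g_simps)

lemma g_sum_right: "g r v (\<Sum>i\<in>I. u i) = (\<Sum>i\<in>I. g r v (u i))"
  by (induction I rule: infinite_finite_induct) (simp_all add: g_simps)

lemma g_eq_0_iff: "g r u u = 0 \<longleftrightarrow> u = 0"
  using g_pos[of u r] bilinear_lzero[OF g_bilinear] by (cases "u = 0") auto

lemma g_coord_smooth:
  assumes "d \<in> B"
  shows "smooth_fun_on B (chart_dom d) (\<lambda>r. g r (coord_vec B d r v) (coord_vec B d r w))"
  by (rule N.smooth_fun_chartI[OF assms N.chart_dom_open[OF assms] order_refl])
     (use metric assms in \<open>simp add: riemannian_metric_def\<close>)

lemma g_along_smooth:
  assumes "open U" "smooth_along U Y" "smooth_along U Z"
  shows "smooth_fun_on A U (\<lambda>q. g (f q) (Y q) (Z q))"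
proof (rule M.smooth_fun_local)
  fix p assume p: "p \<in> U"
  let ?d = "chart_at B (f p)"
  let ?W = "U \<inter> f -` chart_dom ?d"
  note d = N.chart_at_mem[of "f p"]
  note W = nbhd_chart_at[OF assms(1) p]
  let ?y = "\<lambda>i q. vec_in B ?d (f q) (Y q) \<bullet> i" and ?z = "\<lambda>i q. vec_in B ?d (f q) (Z q) \<bullet> i"
  let ?E = "\<lambda>i r. coord_vec B ?d r i"
  have y: "smooth_fun_on A ?W (?y i)" for i by (rule smooth_component[OF assms(1,2) d])
  have z: "smooth_fun_on A ?W (?z i)" for i by (rule smooth_component[OF assms(1,3) d])
  have G: "smooth_fun_on A ?W (\<lambda>q. g (f q) (?E i (f q)) (?E j (f q)))" for i j
    by (rule M.smooth_fun_subset[OF smooth_fun_pullback[OF N.chart_dom_open[OF d] g_coord_smooth[OF d]]]) simp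
  have "smooth_fun_on A ?W (\<lambda>q. \<Sum>i\<in>Basis. \<Sum>j\<in>Basis. ?y i q * (?z j q * g (f q) (?E i (f q)) (?E j (f q))))"
    by (intro M.smooth_fun_sum[OF W(1)] M.smooth_fun_mult[OF W(1)] y z G)
  then have "smooth_fun_on A ?W (\<lambda>q. g (f q) (Y q) (Z q))"
  proof (rule M.smooth_fun_cong[OF W(1), rotated])
    fix q assume "q \<in> ?W"
    then have q: "f q \<in> chart_dom ?d" by simp
    have "g (f q) (Y q) (Z q) = g (f q) (\<Sum>i\<in>Basis. ?y i q *\<^sub>R ?E i (f q)) (\<Sum>i\<in>Basis. ?z i q *\<^sub>R ?E i (f q))"
      using N.coord_vec_expansion[OF d q, of "Y q"] N.coord_vec_expansion[OF d q, of "Z q"] by simp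
    also have "\<dots> = (\<Sum>i\<in>Basis. g (f q) (?y i q *\<^sub>R ?E i (f q)) (\<Sum>i\<in>Basis. ?z i q *\<^sub>R ?E i (f q)))"
      by (rule g_sum_left)
    finally show "(\<Sum>i\<in>Basis. \<Sum>j\<in>Basis. ?y i q * (?z j q * g (f q) (?E i (f q)) (?E j (f q)))) = g (f q) (Y q) (Z q)"
      by (simp add: g_sum_right g_simps sum_distrib_left mult.left_commute)
  qed
  with W show "\<exists>W. open W \<and> p \<in> W \<and> smooth_fun_on A W (\<lambda>q. g (f q) (Y q) (Z q))" by blast
qed

lemma nab_metric:
  assumes "open U" "p \<in> U" "smooth_vf_on B U Y" "smooth_vf_on B U Z"
  shows "dfun B (\<lambda>q. g q (Y q) (Z q)) p u = g p (nab p u Y) (Z p) + g p (Y p) (nab p u Z)"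
  using levi_civita[unfolded levi_civita_def, THEN conjunct2, THEN spec, THEN mp, OF assms(1),
      THEN conjunct2, rule_format, OF assms(3,4,2)] .

text \<open>Compatibility with the metric passes from the summands \<open>Y i\<close> to combinations with function
  coefficients. Used once in each argument of \<open>g\<close>, this reduces \<open>cov_metric\<close> to coordinate fields,
  where it is the compatibility of \<open>nab\<close>.\<close>

lemma metric_compatible_combination:
  assumes "open U" "p \<in> U" "\<And>i. i \<in> I \<Longrightarrow> smooth_fun_on A U (s i)"
    "\<And>i. i \<in> I \<Longrightarrow> smooth_along U (Y i)" "smooth_along U Z"
    "\<And>i. i \<in> I \<Longrightarrow> dfun A (\<lambda>q. g (f q) (Y i q) (Z q)) p u = g (f p) (cov p u (Y i)) (Z p) + g (f p) (Y i p) (cov p u Z)"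
  shows "dfun A (\<lambda>q. g (f q) (\<Sum>i\<in>I. s i q *\<^sub>R Y i q) (Z q)) p u =
    g (f p) (cov p u (\<lambda>q. \<Sum>i\<in>I. s i q *\<^sub>R Y i q)) (Z p) + g (f p) (\<Sum>i\<in>I. s i p *\<^sub>R Y i p) (cov p u Z)"
proof -
  have c: "cov p u (\<lambda>q. \<Sum>i\<in>I. s i q *\<^sub>R Y i q) = (\<Sum>i\<in>I. dfun A (s i) p u *\<^sub>R Y i p + s i p *\<^sub>R cov p u (Y i))"
    using assms(3,4)
    by (simp add: cov_sum[OF assms(1,2)] smooth_along_scaleR[OF assms(1)] cov_scaleR[OF assms(1,2)])
  have "dfun A (\<lambda>q. g (f q) (\<Sum>i\<in>I. s i q *\<^sub>R Y i q) (Z q)) p u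
      = dfun A (\<lambda>q. \<Sum>i\<in>I. s i q * g (f q) (Y i q) (Z q)) p u"
    by (simp add: g_sum_left g_simps)
  also have "\<dots> = (\<Sum>i\<in>I. dfun A (\<lambda>q. s i q * g (f q) (Y i q) (Z q)) p u)"
    by (rule M.dfun_sum[OF assms(1,2)])
       (intro M.smooth_fun_mult[OF assms(1)] g_along_smooth[OF assms(1)] assms(3,4,5))
  also have "\<dots> = (\<Sum>i\<in>I. s i p * (g (f p) (cov p u (Y i)) (Z p) + g (f p) (Y i p) (cov p u Z))
      + dfun A (s i) p u * g (f p) (Y i p) (Z p))"
    by (rule sum.cong[OF refl])
       (simp add: M.dfun_mult[OF assms(1,2) assms(3) g_along_smooth[OF assms(1) assms(4) assms(5)]] assms(6))
  finally show ?thesis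
    by (simp add: c g_sum_left g_simps sum.distrib algebra_simps)
qed

text \<open>Step \<open>EE\<close> is the case of two coordinate fields, \<open>EZ\<close> frees the second field by symmetry of \<open>g\<close>, and the
  last step frees the first.\<close>

lemma cov_metric:
  assumes "open U" "p \<in> U" "smooth_along U Y" "smooth_along U Z"
  shows "dfun A (\<lambda>q. g (f q) (Y q) (Z q)) p u = g (f p) (cov p u Y) (Z p) + g (f p) (Y p) (cov p u Z)"
proof -
  let ?d = "chart_at B (f p)"
  let ?W = "U \<inter> f -` chart_dom ?d"
  note d = N.chart_at_mem[of "f p"]
  note W = nbhd_chart_at[OF assms(1,2)]
  note vf = N.chart_dom_open[OF d] N.smooth_vf_coord_vec[OF d]
  let ?y = "\<lambda>i q. vec_in B ?d (f q) (Y q) \<bullet> i" and ?z = "\<lambda>i q. vec_in B ?d (f q) (Z q) \<bullet> i"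
  let ?E = "\<lambda>i q. coord_vec B ?d (f q) i"
  have y: "smooth_fun_on A ?W (?y i)" for i by (rule smooth_component[OF assms(1,3) d])
  have z: "smooth_fun_on A ?W (?z i)" for i by (rule smooth_component[OF assms(1,4) d])
  have E: "smooth_along ?W (?E i)" for i
    by (rule smooth_along_subset[OF smooth_along_pullback[OF vf]]) simp
  have Z: "smooth_along ?W Z" by (rule smooth_along_subset[OF assms(4)]) simp
  have Yeq: "Y q = (\<Sum>i\<in>Basis. ?y i q *\<^sub>R ?E i q)" and Zeq: "Z q = (\<Sum>i\<in>Basis. ?z i q *\<^sub>R ?E i q)"
    if "q \<in> ?W" for q using that by (intro N.coord_vec_expansion[OF d]; simp)+
  have EE: "dfun A (\<lambda>q. g (f q) (?E i q) (?E j q)) p u = g (f p) (cov p u (?E i)) (?E j p) + g (f p) (?E i p) (cov p u (?E j))" for i j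
    using dfun_dmap[OF vf(1) N.chart_at_dom g_coord_smooth[OF d, of i j], of u]
      nab_metric[OF vf(1) N.chart_at_dom vf(2)[of i] vf(2)[of j], of "dmap A B f p u"]
    by (simp add: cov_pullback[OF vf(1) N.chart_at_dom vf(2)])
  have EZ: "dfun A (\<lambda>q. g (f q) (?E i q) (Z q)) p u = g (f p) (cov p u (?E i)) (Z p) + g (f p) (?E i p) (cov p u Z)" for i
  proof -
    have "dfun A (\<lambda>q. g (f q) (?E i q) (Z q)) p u = dfun A (\<lambda>q. g (f q) (\<Sum>j\<in>Basis. ?z j q *\<^sub>R ?E j q) (?E i q)) p u"
      by (rule M.dfun_cong[OF W]) (simp only: Zeq[symmetric] g_sym)
    also have "\<dots> = g (f p) (cov p u (\<lambda>q. \<Sum>j\<in>Basis. ?z j q *\<^sub>R ?E j q)) (?E i p) + g (f p) (\<Sum>j\<in>Basis. ?z j p *\<^sub>R ?E j p) (cov p u (?E i))"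
      by (rule metric_compatible_combination[OF W z E E EE])
    also have "\<dots> = g (f p) (cov p u Z) (?E i p) + g (f p) (Z p) (cov p u (?E i))"
      using cov_cong[OF W Zeq] Zeq[OF W(2)] by simp
    finally show ?thesis by (simp add: g_sym add.commute)
  qed
  have "dfun A (\<lambda>q. g (f q) (Y q) (Z q)) p u = dfun A (\<lambda>q. g (f q) (\<Sum>j\<in>Basis. ?y j q *\<^sub>R ?E j q) (Z q)) p u"
    by (rule M.dfun_cong[OF W]) (simp only: Yeq[symmetric])
  also have "\<dots> = g (f p) (cov p u (\<lambda>q. \<Sum>j\<in>Basis. ?y j q *\<^sub>R ?E j q)) (Z p) + g (f p) (\<Sum>j\<in>Basis. ?y j p *\<^sub>R ?E j p) (cov p u Z)"
    by (rule metric_compatible_combination[OF W y E Z EZ])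
  also have "\<dots> = g (f p) (cov p u Y) (Z p) + g (f p) (Y p) (cov p u Z)"
    using cov_cong[OF W Yeq] Yeq[OF W(2)] by simp
  finally show ?thesis .
qed

end

section \<open>Frames, second fundamental form and mean curvature of an immersion\<close>

locale riemannian_immersion = metric_along A B f nab g
  for A :: "('m::{t2_space, second_countable_topology}, 'a::euclidean_space) atlas"
    and B :: "('n::{t2_space, second_countable_topology}, 'b::euclidean_space) atlas"
    and f :: "'m \<Rightarrow> 'n" and nab :: "('n, 'b) connection"
    and g :: "'n \<Rightarrow> 'b \<Rightarrow> 'b \<Rightarrow> real" +
  fixes gM :: "'m \<Rightarrow> 'a \<Rightarrow> 'a \<Rightarrow> real"
  assumes metric_M: "riemannian_metric A gM" and isometric: "isometric_immersion A gM B g f"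
begin

abbreviation df :: "'m \<Rightarrow> 'a \<Rightarrow> 'b" where "df \<equiv> dmap A B f"
abbreviation tanp :: "'m \<Rightarrow> 'b \<Rightarrow> 'a" where "tanp \<equiv> tan_part A B g f"
abbreviation norp :: "'m \<Rightarrow> 'b \<Rightarrow> 'b" where "norp \<equiv> nor_part A B g f"
abbreviation sff where "sff \<equiv> second_ff A B g nab f"
abbreviation mean where "mean \<equiv> mean_curvature A gM B g nab f"

lemma gM_bilinear: "bilinear (gM p)" and gM_sym: "gM p u v = gM p v u"
  and gM_pos: "u \<noteq> 0 \<Longrightarrow> gM p u u > 0"
  using metric_M unfolding riemannian_metric_def by auto

lemmas gM_simps = bilinear_ladd[OF gM_bilinear] bilinear_radd[OF gM_bilinear]
  bilinear_lmul[OF gM_bilinear] bilinear_rmul[OF gM_bilinear]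
  bilinear_lsub[OF gM_bilinear] bilinear_rsub[OF gM_bilinear]
  bilinear_lzero[OF gM_bilinear] bilinear_rzero[OF gM_bilinear]

lemma gM_sum_left: "gM r (\<Sum>i\<in>I. u i) v = (\<Sum>i\<in>I. gM r (u i) v)"
  by (induction I rule: infinite_finite_induct) (simp_all add: gM_simps)

lemma gM_eqI: assumes "\<And>v. gM p u v = gM p u' v" shows "u = u'"
  using gM_pos[of "u - u'" p] assms[of "u - u'"] by (force simp: gM_simps)

lemma g_df: "g (f p) (df p u) (df p v) = gM p u v"
  using isometric unfolding isometric_immersion_def by simp

lemma gM_smooth:
  assumes "open U" "smooth_vf_on A U X" "smooth_vf_on A U Y"
  shows "smooth_fun_on A U (\<lambda>q. gM q (X q) (Y q))"
  using g_along_smooth[OF assms(1) smooth_along_dmap[OF assms(1,2)] smooth_along_dmap[OF assms(1,3)]]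
  by (simp add: g_df)

subsection \<open>Orthonormal frames\<close>

lemma frame_open: "orthonormal_frame A gM U e \<Longrightarrow> open U"
  and frame_smooth: "orthonormal_frame A gM U e \<Longrightarrow> i \<in> {1..DIM('a)} \<Longrightarrow> smooth_vf_on A U (e i)"
  and frame_orthonormal: "orthonormal_frame A gM U e \<Longrightarrow> p \<in> U \<Longrightarrow> i \<in> {1..DIM('a)} \<Longrightarrow>
    j \<in> {1..DIM('a)} \<Longrightarrow> gM p (e i p) (e j p) = (if i = j then 1 else 0)"
  unfolding orthonormal_frame_def by blast+

text \<open>The map that sends coefficients to combinations of the \<open>E i\<close> is injective, because the coefficients
  are recovered by \<open>gM\<close>; equality of dimensions makes it surjective.\<close>

lemma orthonormal_expansion:
  fixes E :: "nat \<Rightarrow> 'a"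
  assumes "\<And>i j. i \<in> {1..DIM('a)} \<Longrightarrow> j \<in> {1..DIM('a)} \<Longrightarrow> gM p (E i) (E j) = (if i = j then 1 else 0)"
  shows "u = (\<Sum>i = 1..DIM('a). gM p u (E i) *\<^sub>R E i)"
proof -
  obtain b :: "nat \<Rightarrow> 'a" where b: "bij_betw b {1..DIM('a)} Basis"
    using finite_same_card_bij[of "{1..DIM('a)}" "Basis :: 'a set"] by auto
  define L where "L c = (\<Sum>i = 1..DIM('a). (c \<bullet> b i) *\<^sub>R E i)" for c :: 'a
  have coeff: "gM p (L c) (E j) = c \<bullet> b j" if "j \<in> {1..DIM('a)}" for c j
  proof -
    have "gM p (L c) (E j) = (\<Sum>i = 1..DIM('a). if i = j then c \<bullet> b i else 0)"
      unfolding L_def gM_sum_left by (rule sum.cong) (use assms that in \<open>auto simp: gM_simps\<close>)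
    then show ?thesis using that by simp
  qed
  have "linear L"
    unfolding L_def by (rule linearI) (simp_all add: inner_add_left algebra_simps sum.distrib scaleR_sum_right)
  moreover have "inj L"
  proof (rule injI)
    fix c c' assume "L c = L c'"
    then have "c \<bullet> b j = c' \<bullet> b j" if "j \<in> {1..DIM('a)}" for j using coeff[OF that] by metis
    then have "c \<bullet> i = c' \<bullet> i" if "i \<in> Basis" for i
      using that b by (metis bij_betw_imp_surj_on imageE)
    then show "c = c'" by (rule euclidean_eqI)
  qed
  ultimately have "surj L" using linear_injective_imp_surjective by blast
  then obtain c where c: "u = L c" by blast
  have "(\<Sum>i = 1..DIM('a). gM p u (E i) *\<^sub>R E i) = L c"
    unfolding c by (subst L_def) (rule sum.cong, simp_all add: coeff)
  then show ?thesis using c by simp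
qed

text \<open>Orthonormalisation of the coordinate fields, simultaneously at all points of the chart domain. The
  condition on spans keeps the induction going: it shows that the next coordinate vector is not a
  combination of the frame vectors constructed so far, so the vector to be normalised is not zero.\<close>

lemma gram_schmidt:
  assumes d: "d \<in> A" and b: "bij_betw b {1..DIM('a)} (Basis :: 'a set)" and "k \<le> DIM('a)"
  shows "\<exists>e. (\<forall>i\<in>{1..k}. smooth_vf_on A (chart_dom d) (e i)) \<and>
    (\<forall>p\<in>chart_dom d. \<forall>i\<in>{1..k}. e i p \<in> coord_vec A d p ` span (b ` {1..k})) \<and>
    (\<forall>p\<in>chart_dom d. \<forall>i\<in>{1..k}. \<forall>j\<in>{1..k}. gM p (e i p) (e j p) = (if i = j then 1 else 0))"
  using assms(3)
proof (induction k)
  case 0 then show ?case by auto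
next
  case (Suc k)
  let ?U = "chart_dom d"
  note U = M.chart_dom_open[OF d]
  obtain e where e': "\<forall>i\<in>{1..k}. smooth_vf_on A ?U (e i)"
    "\<forall>p\<in>?U. \<forall>i\<in>{1..k}. e i p \<in> coord_vec A d p ` span (b ` {1..k})"
    "\<forall>p\<in>?U. \<forall>i\<in>{1..k}. \<forall>j\<in>{1..k}. gM p (e i p) (e j p) = (if i = j then 1 else 0)"
    using Suc.IH[OF Suc_leD[OF Suc.prems]] by (elim exE conjE)
  note e = e'[rule_format]
  \<comment> \<open>The next coordinate field, its orthogonal projection to the span of the previous frame vectors,
      and the difference, which is what gets normalised.\<close>
  define V where "V p = coord_vec A d p (b (Suc k))" for p
  have V: "smooth_vf_on A ?U V" unfolding V_def by (rule M.smooth_vf_coord_vec[OF d])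
  define S where "S p = (\<Sum>i = 1..k. gM p (V p) (e i p) *\<^sub>R e i p)" for p
  define w where "w p = V p + (- 1) *\<^sub>R S p" for p
  define e' where "e' i p = (if i = Suc k then (gM p (w p) (w p) powr (- 1 / 2)) *\<^sub>R w p else e i p)" for i p
  have S: "smooth_vf_on A ?U S" unfolding S_def
    by (intro M.smooth_vf_sum[OF U] M.smooth_vf_scaleR[OF U] gM_smooth[OF U] V e)
  have w: "smooth_vf_on A ?U w" unfolding w_def
    by (intro M.smooth_vf_add[OF U] M.smooth_vf_scaleR[OF U] M.smooth_fun_const V S)
  have sub: "subspace (coord_vec A d p ` span (b ` {1..k}))" if "p \<in> ?U" for p
    by (intro linear_subspace_image M.coord_vec_linear d that subspace_span)
  have S_span: "S p \<in> coord_vec A d p ` span (b ` {1..k})" if "p \<in> ?U" for p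
    unfolding S_def by (intro subspace_sum[OF sub[OF that]] subspace_mul[OF sub[OF that]] e that)
  have w_nonzero: "w p \<noteq> 0" if p: "p \<in> ?U" for p
  proof
    assume "w p = 0"
    then have "V p = S p" by (simp add: w_def)
    then obtain x where x: "x \<in> span (b ` {1..k})" "coord_vec A d p (b (Suc k)) = coord_vec A d p x"
      using S_span[OF p] unfolding V_def by auto
    then have "b (Suc k) = x" using M.vec_in_coord_vec[OF d p] by metis
    then have *: "b (Suc k) \<in> span (b ` {1..k})" using x(1) by simp
    have "b ` {1..k} \<subseteq> Basis - {b (Suc k)}"
    proof
      fix y assume "y \<in> b ` {1..k}"
      then obtain i where i: "i \<in> {1..k}" "y = b i" by blast
      have "i \<in> {1..DIM('a)}" "Suc k \<in> {1..DIM('a)}" "i \<noteq> Suc k" using i Suc.prems by auto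
      then have "b i \<noteq> b (Suc k)" using bij_betw_imp_inj_on[OF b] by (metis inj_onD)
      then show "y \<in> Basis - {b (Suc k)}"
        using i(2) bij_betwE[OF b] \<open>i \<in> {1..DIM('a)}\<close> by auto
    qed
    then have "b (Suc k) \<in> span (Basis - {b (Suc k)})" using * span_mono[of "b ` {1..k}"] by blast
    moreover have "b (Suc k) \<in> Basis" using bij_betwE[OF b] Suc.prems by auto
    ultimately have "dependent (Basis :: 'a set)" unfolding dependent_def by blast
    then show False using independent_Basis by blast
  qed
  have N_pos: "gM p (w p) (w p) > 0" if "p \<in> ?U" for p using gM_pos w_nonzero that by blast
  have w_e: "gM p (w p) (e j p) = 0" if p: "p \<in> ?U" and j: "j \<in> {1..k}" for p j
  proof -
    have "gM p (S p) (e j p) = (\<Sum>i = 1..k. if i = j then gM p (V p) (e i p) else 0)"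
      unfolding S_def gM_sum_left by (rule sum.cong) (use e(3)[OF p] j in \<open>auto simp: gM_simps\<close>)
    then have "gM p (S p) (e j p) = gM p (V p) (e j p)" using j by simp
    then show ?thesis by (simp add: w_def gM_simps)
  qed
  have normed: "x powr (- 1 / 2) * (x powr (- 1 / 2) * x) = 1" if "x > 0" for x :: real
    using that powr_add[of x "-1/2" "-1/2"] by (simp add: powr_minus_divide flip: mult.assoc)
  have 1: "smooth_vf_on A ?U (e' i)" if "i \<in> {1..Suc k}" for i
  proof (cases "i = Suc k")
    case True
    have "smooth_fun_on A ?U (\<lambda>p. gM p (w p) (w p) powr (- 1 / 2))"
      by (rule M.smooth_fun_compose[OF U gM_smooth[OF U w w] open_greaterThan _ smooth_on_powr])
         (use N_pos in auto)
    then show ?thesis unfolding e'_def using True by (simp add: M.smooth_vf_scaleR[OF U _ w])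
  next
    case False
    then have "e' i = e i" by (auto simp: e'_def)
    then show ?thesis using e(1)[of i] False that by auto
  qed
  have 2: "e' i p \<in> coord_vec A d p ` span (b ` {1..Suc k})" if p: "p \<in> ?U" and i: "i \<in> {1..Suc k}" for p i
  proof -
    have sub': "subspace (coord_vec A d p ` span (b ` {1..Suc k}))"
      by (intro linear_subspace_image M.coord_vec_linear d p subspace_span)
    have mono: "coord_vec A d p ` span (b ` {1..k}) \<subseteq> coord_vec A d p ` span (b ` {1..Suc k})"
      by (intro image_mono span_mono) auto
    show ?thesis
    proof (cases "i = Suc k")
      case True
      have "V p \<in> coord_vec A d p ` span (b ` {1..Suc k})"
        unfolding V_def by (intro imageI span_base) auto
      then have "w p \<in> coord_vec A d p ` span (b ` {1..Suc k})"
        unfolding w_def using S_span[OF p] mono by (intro subspace_add[OF sub'] subspace_mul[OF sub']) auto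
      then have "gM p (w p) (w p) powr (- 1 / 2) *\<^sub>R w p \<in> coord_vec A d p ` span (b ` {1..Suc k})"
        by (rule subspace_mul[OF sub'])
      then show ?thesis unfolding e'_def using True by simp
    next
      case False
      then have "i \<in> {1..k}" using i by auto
      then have "e i p \<in> coord_vec A d p ` span (b ` {1..Suc k})" using e(2)[OF p] mono by blast
      then show ?thesis unfolding e'_def using False by simp
    qed
  qed
  have 3: "gM p (e' i p) (e' j p) = (if i = j then 1 else 0)"
    if p: "p \<in> ?U" and i: "i \<in> {1..Suc k}" and j: "j \<in> {1..Suc k}" for p i j
  proof -
    consider "i = Suc k" "j = Suc k" | "i = Suc k" "j \<in> {1..k}" | "i \<in> {1..k}" "j = Suc k"
      | "i \<in> {1..k}" "j \<in> {1..k}"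
      using i j by force
    then show ?thesis
    proof cases
      case 1 then show ?thesis using normed[OF N_pos[OF p]] by (simp add: e'_def gM_simps)
    next
      case 2 then show ?thesis using w_e[OF p] by (auto simp: e'_def gM_simps)
    next
      case 3 then show ?thesis using w_e[OF p] by (auto simp: e'_def gM_simps gM_sym[of p "e i p" "w p"])
    next
      case 4 then show ?thesis using e(3)[OF p] by (auto simp: e'_def)
    qed
  qed
  show ?case by (intro exI[of _ e'] conjI ballI 1 2 3)
qed

lemma ex_orthonormal_frame: "\<exists>U e. orthonormal_frame A gM U e \<and> p \<in> U"
proof -
  obtain b :: "nat \<Rightarrow> 'a" where b: "bij_betw b {1..DIM('a)} Basis"
    using finite_same_card_bij[of "{1..DIM('a)}" "Basis :: 'a set"] by auto
  from gram_schmidt[OF M.chart_at_mem b order_refl, of p]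
  obtain e where "orthonormal_frame A gM (chart_dom (chart_at A p)) e"
    unfolding orthonormal_frame_def using M.chart_dom_open[OF M.chart_at_mem] by blast
  then show ?thesis using M.chart_at_dom by blast
qed

subsection \<open>Tangent and normal parts\<close>

text \<open>Uniqueness of the tangent part comes from positivity of \<open>gM\<close>, the metric induced by \<open>g\<close>.\<close>

lemma tan_part_eqI:
  assumes "\<And>v. gM p u v = g (f p) w (df p v)"
  shows "tanp p w = u"
  unfolding tan_part_def
proof (rule the_equality)
  show "\<forall>v. g (f p) (w - df p u) (df p v) = 0" using assms by (simp add: g_simps g_df)
  fix u' assume "\<forall>v. g (f p) (w - df p u') (df p v) = 0"
  then have "gM p u' v = gM p u v" for v using assms by (simp add: g_simps g_df)
  then show "u' = u" by (rule gM_eqI)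
qed

lemma gM_frame_coefficients:
  assumes "orthonormal_frame A gM U e" "p \<in> U"
  shows "gM p (\<Sum>i = 1..DIM('a). g (f p) w (df p (e i p)) *\<^sub>R e i p) v = g (f p) w (df p v)"
proof -
  have "v = (\<Sum>i = 1..DIM('a). gM p v (e i p) *\<^sub>R e i p)"
    by (rule orthonormal_expansion) (rule frame_orthonormal[OF assms])
  then have "g (f p) w (df p v) =
      g (f p) w (df p (\<Sum>i = 1..DIM('a). gM p v (e i p) *\<^sub>R e i p))" by simp
  also have "\<dots> = (\<Sum>i = 1..DIM('a). gM p v (e i p) * g (f p) w (df p (e i p)))"
    by (simp add: linear_sum[OF dmap_linear] linear_cmul[OF dmap_linear] g_sum_right g_simps)
  finally show ?thesis
    by (simp add: gM_sum_left gM_simps gM_sym[of p v] mult.commute)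
qed

text \<open>Existence of the tangent part, in a form from which its smoothness can be read off.\<close>

lemma tan_part_frame:
  assumes "orthonormal_frame A gM U e" "p \<in> U"
  shows "tanp p w = (\<Sum>i = 1..DIM('a). g (f p) w (df p (e i p)) *\<^sub>R e i p)"
  by (rule tan_part_eqI) (rule gM_frame_coefficients[OF assms])

lemma gM_tan_part: "gM p (tanp p w) v = g (f p) w (df p v)"
proof -
  obtain U e where e: "orthonormal_frame A gM U e" "p \<in> U" using ex_orthonormal_frame by blast
  show ?thesis unfolding tan_part_frame[OF e] by (rule gM_frame_coefficients[OF e])
qed

lemma tan_part_linear: "linear (tanp p)"
  by (rule linearI; rule tan_part_eqI) (simp_all add: gM_simps g_simps gM_tan_part)

lemma tan_part_df: "tanp p (df p u) = u"
  by (rule tan_part_eqI) (simp add: g_df)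

lemma nor_part_linear: "linear (norp p)"
  by (rule linearI)
     (simp_all add: nor_part_def linear_add[OF tan_part_linear] linear_cmul[OF tan_part_linear]
        linear_add[OF dmap_linear] linear_cmul[OF dmap_linear] algebra_simps)

lemma nor_part_df: "norp p (df p u) = 0"
  by (simp add: nor_part_def tan_part_df)

lemma g_nor_part_df: "g (f p) (norp p w) (df p v) = 0"
  by (simp add: nor_part_def g_simps g_df gM_tan_part)

lemma tan_nor_decomposition: "w = df p (tanp p w) + norp p w"
  by (simp add: nor_part_def)

lemma g_nor_part: assumes "\<And>v. g (f p) \<xi> (df p v) = 0" shows "g (f p) (norp p w) \<xi> = g (f p) w \<xi>"
  using assms by (simp add: nor_part_def g_simps g_sym[of _ "df p _" \<xi>])

lemma smooth_tan_part:
  assumes "open U" "smooth_along U Y"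
  shows "smooth_vf_on A U (\<lambda>q. tanp q (Y q))"
proof (rule M.smooth_vf_local[OF assms(1)])
  fix p assume p: "p \<in> U"
  obtain V e where e: "orthonormal_frame A gM V e" "p \<in> V" using ex_orthonormal_frame by blast
  let ?W = "U \<inter> V"
  have W: "open ?W" "p \<in> ?W" using frame_open[OF e(1)] e(2) p assms(1) by auto
  have vf: "smooth_vf_on A ?W (e i)" if "i \<in> {1..DIM('a)}" for i
    by (rule M.smooth_vf_subset[OF frame_smooth[OF e(1) that]]) simp
  have Y: "smooth_along ?W Y" by (rule smooth_along_subset[OF assms(2)]) simp
  have "smooth_vf_on A ?W (\<lambda>q. \<Sum>i = 1..DIM('a). g (f q) (Y q) (df q (e i q)) *\<^sub>R e i q)"
    by (intro M.smooth_vf_sum[OF W(1)] M.smooth_vf_scaleR[OF W(1)] g_along_smooth[OF W(1)] Y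
        smooth_along_dmap[OF W(1)] vf)
  then have "smooth_vf_on A ?W (\<lambda>q. tanp q (Y q))"
    by (rule M.smooth_vf_cong[OF W(1), rotated]) (simp add: tan_part_frame[OF e(1)])
  with W show "\<exists>W. open W \<and> p \<in> W \<and> smooth_vf_on A W (\<lambda>q. tanp q (Y q))" by blast
qed

lemma smooth_nor_part:
  assumes "open U" "smooth_along U Y"
  shows "smooth_along U (\<lambda>q. norp q (Y q))"
  unfolding nor_part_def
  by (intro smooth_along_diff assms smooth_along_dmap smooth_tan_part)

subsection \<open>The second fundamental form and the mean curvature\<close>

text \<open>The second fundamental form is bilinear over functions: differentiating the coefficients produces
  multiples of the tangent vectors \<open>df (e i)\<close>, which the normal part removes.\<close>

lemma sff_combination:
  assumes "open U" "p \<in> U" "\<And>i. i \<in> I \<Longrightarrow> smooth_vf_on A U (e i)"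
    "\<And>i. i \<in> I \<Longrightarrow> smooth_fun_on A U (a i)" "\<And>q. q \<in> U \<Longrightarrow> X q = (\<Sum>i\<in>I. a i q *\<^sub>R e i q)"
  shows "sff X X p = (\<Sum>i\<in>I. \<Sum>j\<in>I. (a i p * a j p) *\<^sub>R sff (e j) (e i) p)"
proof -
  have E: "smooth_along U (\<lambda>q. df q (e i q))" if "i \<in> I" for i
    by (rule smooth_along_dmap[OF assms(1) assms(3)[OF that]])
  have "cov p u (\<lambda>q. df q (X q)) = cov p u (\<lambda>q. \<Sum>i\<in>I. a i q *\<^sub>R df q (e i q))" for u
    by (rule cov_cong[OF assms(1,2)])
       (simp add: assms(5) linear_sum[OF dmap_linear] linear_cmul[OF dmap_linear])
  also have "\<And>u. cov p u (\<lambda>q. \<Sum>i\<in>I. a i q *\<^sub>R df q (e i q)) =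
      (\<Sum>i\<in>I. dfun A (a i) p u *\<^sub>R df p (e i p) + a i p *\<^sub>R cov p u (\<lambda>q. df q (e i q)))"
    using E assms(4)
    by (simp add: cov_sum[OF assms(1,2)] smooth_along_scaleR[OF assms(1)] cov_scaleR[OF assms(1,2)])
  finally have "sff X X p = (\<Sum>i\<in>I. a i p *\<^sub>R norp p (cov p (X p) (\<lambda>q. df q (e i q))))"
    by (simp add: second_ff_def linear_sum[OF nor_part_linear] linear_add[OF nor_part_linear]
        linear_cmul[OF nor_part_linear] nor_part_df)
  also have "\<dots> = (\<Sum>i\<in>I. a i p *\<^sub>R (\<Sum>j\<in>I. a j p *\<^sub>R sff (e j) (e i) p))"
  proof (rule sum.cong[OF refl])
    fix i assume i: "i \<in> I"
    note lin = cov_linear[OF assms(1,2) E[OF i]]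
    have "cov p (X p) (\<lambda>q. df q (e i q)) = (\<Sum>j\<in>I. a j p *\<^sub>R cov p (e j p) (\<lambda>q. df q (e i q)))"
      by (simp add: assms(2,5) linear_sum[OF lin] linear_cmul[OF lin])
    then show "a i p *\<^sub>R norp p (cov p (X p) (\<lambda>q. df q (e i q))) = a i p *\<^sub>R (\<Sum>j\<in>I. a j p *\<^sub>R sff (e j) (e i) p)"
      by (simp add: second_ff_def linear_sum[OF nor_part_linear] linear_cmul[OF nor_part_linear])
  qed
  finally show ?thesis by (simp add: scaleR_sum_right)
qed

text \<open>The coefficients \<open>?a i j\<close> of one frame in the other form an orthogonal matrix (\<open>orth\<close>), and traces
  of bilinear forms are invariant under orthogonal changes of basis.\<close>

lemma sff_trace_frame_independent:
  assumes e: "orthonormal_frame A gM U e" "p \<in> U" and e': "orthonormal_frame A gM U' e'" "p \<in> U'"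
  shows "(\<Sum>i = 1..DIM('a). sff (e' i) (e' i) p) = (\<Sum>i = 1..DIM('a). sff (e i) (e i) p)"
proof -
  let ?I = "{1..DIM('a)}"
  let ?W = "U \<inter> U'"
  let ?a = "\<lambda>i j q. gM q (e' i q) (e j q)"
  have W: "open ?W" "p \<in> ?W" using frame_open[OF e(1)] frame_open[OF e'(1)] e(2) e'(2) by auto
  have vf: "smooth_vf_on A ?W (e i)" "smooth_vf_on A ?W (e' i)" if "i \<in> ?I" for i
    by (rule M.smooth_vf_subset[OF frame_smooth[OF e(1) that]], simp)
       (rule M.smooth_vf_subset[OF frame_smooth[OF e'(1) that]], simp)
  have ON: "gM q (e i q) (e j q) = (if i = j then 1 else 0)" "gM q (e' i q) (e' j q) = (if i = j then 1 else 0)"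
    if "q \<in> ?W" "i \<in> ?I" "j \<in> ?I" for q i j
    using frame_orthonormal[OF e(1) _ that(2,3)] frame_orthonormal[OF e'(1) _ that(2,3)] that(1) by auto
  have h: "sff (e' i) (e' i) p = (\<Sum>j\<in>?I. \<Sum>k\<in>?I. (?a i j p * ?a i k p) *\<^sub>R sff (e k) (e j) p)" if i: "i \<in> ?I" for i
  proof (rule sff_combination[OF W])
    show "smooth_vf_on A ?W (e j)" if "j \<in> ?I" for j by (rule vf(1)[OF that])
    show "smooth_fun_on A ?W (?a i j)" if "j \<in> ?I" for j by (rule gM_smooth[OF W(1) vf(2)[OF i] vf(1)[OF that]])
    show "e' i q = (\<Sum>j\<in>?I. ?a i j q *\<^sub>R e j q)" if "q \<in> ?W" for q
      by (rule orthonormal_expansion) (rule ON(1)[OF that])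
  qed
  have orth: "(\<Sum>i\<in>?I. ?a i j p * ?a i k p) = (if j = k then 1 else 0)" if "j \<in> ?I" "k \<in> ?I" for j k
  proof -
    have "e j p = (\<Sum>i\<in>?I. gM p (e j p) (e' i p) *\<^sub>R e' i p)"
      by (rule orthonormal_expansion) (rule ON(2)[OF W(2)])
    then have "gM p (e j p) (e k p) = gM p (\<Sum>i\<in>?I. gM p (e j p) (e' i p) *\<^sub>R e' i p) (e k p)" by simp
    also have "\<dots> = (\<Sum>i\<in>?I. ?a i j p * ?a i k p)"
      by (simp add: gM_sum_left gM_simps gM_sym[of p "e j p"])
    finally show ?thesis using ON(1)[OF W(2) that] by simp
  qed
  have "(\<Sum>i\<in>?I. sff (e' i) (e' i) p) = (\<Sum>i\<in>?I. \<Sum>j\<in>?I. \<Sum>k\<in>?I. (?a i j p * ?a i k p) *\<^sub>R sff (e k) (e j) p)"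
    by (rule sum.cong[OF refl h])
  also have "\<dots> = (\<Sum>j\<in>?I. \<Sum>i\<in>?I. \<Sum>k\<in>?I. (?a i j p * ?a i k p) *\<^sub>R sff (e k) (e j) p)"
    by (rule sum.swap)
  also have "\<dots> = (\<Sum>j\<in>?I. \<Sum>k\<in>?I. \<Sum>i\<in>?I. (?a i j p * ?a i k p) *\<^sub>R sff (e k) (e j) p)"
    by (rule sum.cong[OF refl], rule sum.swap)
  also have "\<dots> = (\<Sum>j\<in>?I. \<Sum>k\<in>?I. (if j = k then 1 else 0) *\<^sub>R sff (e k) (e j) p)"
    by (intro sum.cong refl) (simp only: scaleR_sum_left[symmetric] orth)
  also have "\<dots> = (\<Sum>j\<in>?I. sff (e j) (e j) p)"
    by (intro sum.cong refl) (simp add: if_distrib[of "\<lambda>c. c *\<^sub>R _"] cong: if_cong)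
  finally show ?thesis .
qed

lemma mean_curvature_frame:
  assumes "orthonormal_frame A gM U e" "p \<in> U"
  shows "mean p = (1 / real DIM('a)) *\<^sub>R (\<Sum>i = 1..DIM('a). sff (e i) (e i) p)"
  unfolding mean_curvature_def
proof (rule the_equality)
  show "\<forall>U' e'. orthonormal_frame A gM U' e' \<longrightarrow> p \<in> U' \<longrightarrow>
      (1 / real DIM('a)) *\<^sub>R (\<Sum>i = 1..DIM('a). sff (e i) (e i) p) =
      (1 / real DIM('a)) *\<^sub>R (\<Sum>i = 1..DIM('a). sff (e' i) (e' i) p)"
    by (intro allI impI) (simp only: sff_trace_frame_independent[OF assms])
next
  fix w
  assume "\<forall>U' e'. orthonormal_frame A gM U' e' \<longrightarrow> p \<in> U' \<longrightarrow>
      w = (1 / real DIM('a)) *\<^sub>R (\<Sum>i = 1..DIM('a). sff (e' i) (e' i) p)"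
  then show "w = (1 / real DIM('a)) *\<^sub>R (\<Sum>i = 1..DIM('a). sff (e i) (e i) p)"
    using assms by simp
qed

lemma smooth_mean_curvature: "smooth_along UNIV mean"
proof (rule smooth_along_local)
  fix p :: 'm
  obtain U e where e: "orthonormal_frame A gM U e" "p \<in> U" using ex_orthonormal_frame by blast
  have U: "open U" and vf: "\<And>i. i \<in> {1..DIM('a)} \<Longrightarrow> smooth_vf_on A U (e i)"
    by (rule frame_open[OF e(1)], rule frame_smooth[OF e(1)])
  have "smooth_along U (\<lambda>q. (1 / real DIM('a)) *\<^sub>R (\<Sum>i = 1..DIM('a). sff (e i) (e i) q))"
    unfolding second_ff_def
    by (intro smooth_along_scaleR[OF U] M.smooth_fun_const smooth_along_sum[OF U] smooth_nor_part[OF U]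
        cov_smooth[OF U] smooth_along_dmap[OF U] vf)
  then have "smooth_along U mean"
    by (rule smooth_along_cong[OF U, rotated]) (simp add: mean_curvature_frame[OF e(1)])
  with U e(2) show "\<exists>W. open W \<and> p \<in> W \<and> smooth_along W mean" by blast
qed

lemma mean_curvature_normal: "g (f p) (mean p) (df p v) = 0"
proof -
  obtain U e where e: "orthonormal_frame A gM U e" "p \<in> U" using ex_orthonormal_frame by blast
  show ?thesis
    by (simp add: mean_curvature_frame[OF e] g_simps g_sum_left second_ff_def g_nor_part_df)
qed

end

section \<open>The product structure along an immersion\<close>

locale product_immersion = riemannian_immersion A B f nab g gM
  for A :: "('m::{t2_space, second_countable_topology}, 'a::euclidean_space) atlas"
    and B :: "('n::{t2_space, second_countable_topology}, 'b::euclidean_space) atlas"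
    and f :: "'m \<Rightarrow> 'n" and nab :: "('n, 'b) connection"
    and g :: "'n \<Rightarrow> 'b \<Rightarrow> 'b \<Rightarrow> real" and gM :: "'m \<Rightarrow> 'a \<Rightarrow> 'a \<Rightarrow> real" +
  fixes F :: "'n \<Rightarrow> 'b \<Rightarrow> 'b"
  assumes product: "locally_product B g nab F"
begin

lemma F_tensor: "tensor11 B F"
  using product unfolding locally_product_def by blast

lemma F_linear: "linear (F r)"
  using F_tensor unfolding tensor11_def by blast

lemma F_global_parallel:
  assumes "vector_field B X" "vector_field B Y"
  shows "nab r (X r) (\<lambda>q. F q (Y q)) = F r (nab r (X r) Y)"
proof -
  have "\<forall>X Y. vector_field B X \<longrightarrow> vector_field B Y \<longrightarrow>
      (\<forall>r. nab r (X r) (\<lambda>q. F q (Y q)) - F r (nab r (X r) Y) = 0)"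
    using product unfolding locally_product_def by (elim conjE)
  from this[rule_format, OF assms, of r] show ?thesis by simp
qed

lemma F_coord_smooth:
  assumes d: "d \<in> B"
  shows "smooth_vf_on B (chart_dom d) (\<lambda>r. F r (coord_vec B d r v))"
proof -
  note U = N.chart_dom_open[OF d]
  have "smooth_on (chart_map d ` chart_dom d)
      (\<lambda>x. vec_in B d (chart_inv d x) (F (chart_inv d x) (coord_vec B d (chart_inv d x) v)))"
    using F_tensor d unfolding tensor11_def by blast
  from N.smooth_fun_chartI[OF d U order_refl this]
  show ?thesis by (rule N.smooth_vf_chartI[OF d U order_refl])
qed

text \<open>Parallelism of \<open>F\<close> is given for global fields, so it is applied to the coordinate field multiplied by
  a bump function \<open>s\<close>. By the Leibniz rule both sides contain the same term with the derivative of \<open>s\<close>,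
  which cancels.\<close>

lemma F_parallel_coord:
  assumes d: "d \<in> B" "r \<in> chart_dom d"
  shows "nab r w (\<lambda>q. F q (coord_vec B d q v)) = F r (nab r w (\<lambda>q. coord_vec B d q v))"
proof -
  let ?U = "chart_dom d" and ?E = "\<lambda>v q. coord_vec B d q v"
  note U = N.chart_dom_open[OF d(1)]
  obtain s :: "'n \<Rightarrow> real" where s: "s r = 1" "smooth_fun_on B UNIV s"
    "\<And>v. vector_field B (\<lambda>q. s q *\<^sub>R ?E v q)"
    using N.ex_bump[OF d] by blast
  have sU: "smooth_fun_on B ?U s" by (rule N.smooth_fun_subset[OF s(2)]) simp
  have "s r *\<^sub>R ?E (vec_in B d r w) r = w" using s(1) N.coord_vec_vec_in[OF d] by simp
  with F_global_parallel[OF s(3)[of "vec_in B d r w"] s(3)[of v], of r]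
  have "nab r w (\<lambda>q. F q (s q *\<^sub>R ?E v q)) = F r (nab r w (\<lambda>q. s q *\<^sub>R ?E v q))" by simp
  moreover have "nab r w (\<lambda>q. F q (s q *\<^sub>R ?E v q)) =
      dfun B s r w *\<^sub>R F r (?E v r) + nab r w (\<lambda>q. F q (?E v q))"
    using N.nab_scaleR[OF U d(2) sU F_coord_smooth[OF d(1), of v]] s(1) by (simp add: linear_cmul[OF F_linear])
  moreover have "F r (nab r w (\<lambda>q. s q *\<^sub>R ?E v q)) =
      dfun B s r w *\<^sub>R F r (?E v r) + F r (nab r w (?E v))"
    using N.nab_scaleR[OF U d(2) sU N.smooth_vf_coord_vec[OF d(1), of v]] s(1)
    by (simp add: linear_cmul[OF F_linear] linear_add[OF F_linear])
  ultimately show ?thesis by simp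
qed

lemma F_expansion:
  assumes "d \<in> B" "f q \<in> chart_dom d"
  shows "F (f q) u = (\<Sum>i\<in>Basis. (vec_in B d (f q) u \<bullet> i) *\<^sub>R F (f q) (coord_vec B d (f q) i))"
proof -
  have "F (f q) u = F (f q) (\<Sum>i\<in>Basis. (vec_in B d (f q) u \<bullet> i) *\<^sub>R coord_vec B d (f q) i)"
    using N.coord_vec_expansion[OF assms] by simp
  then show ?thesis by (simp add: linear_sum[OF F_linear] linear_cmul[OF F_linear])
qed

lemma smooth_along_F:
  assumes "open U" "smooth_along U Y"
  shows "smooth_along U (\<lambda>q. F (f q) (Y q))"
proof (rule smooth_along_local)
  fix p assume p: "p \<in> U"
  let ?d = "chart_at B (f p)"
  let ?W = "U \<inter> f -` chart_dom ?d"
  note d = N.chart_at_mem[of "f p"]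
  note W = nbhd_chart_at[OF assms(1) p]
  have y: "smooth_fun_on A ?W (\<lambda>q. vec_in B ?d (f q) (Y q) \<bullet> i)" for i
    by (rule smooth_component[OF assms d])
  have FE: "smooth_along ?W (\<lambda>q. F (f q) (coord_vec B ?d (f q) i))" for i
    by (rule smooth_along_subset[OF smooth_along_pullback[OF N.chart_dom_open[OF d] F_coord_smooth[OF d]]]) simp
  have "smooth_along ?W (\<lambda>q. \<Sum>i\<in>Basis. (vec_in B ?d (f q) (Y q) \<bullet> i) *\<^sub>R F (f q) (coord_vec B ?d (f q) i))"
    by (intro smooth_along_sum[OF W(1)] smooth_along_scaleR[OF W(1)] y FE)
  then have "smooth_along ?W (\<lambda>q. F (f q) (Y q))"
    by (rule smooth_along_cong[OF W(1), rotated]) (rule F_expansion[OF d, symmetric], simp)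
  with W show "\<exists>W. open W \<and> p \<in> W \<and> smooth_along W (\<lambda>q. F (f q) (Y q))" by blast
qed

text \<open>\<open>F\<close> is linear at each point and, by \<open>F_parallel_coord\<close>, commutes with \<open>nab\<close> on coordinate fields;
  the expansion of \<open>Y\<close> in coordinate fields carries this over to fields along \<open>f\<close>.\<close>

lemma cov_F:
  assumes "open U" "p \<in> U" "smooth_along U Y"
  shows "cov p u (\<lambda>q. F (f q) (Y q)) = F (f p) (cov p u Y)"
proof -
  let ?d = "chart_at B (f p)"
  let ?W = "U \<inter> f -` chart_dom ?d"
  note d = N.chart_at_mem[of "f p"] and fp = N.chart_at_dom[of "f p"]
  note W = nbhd_chart_at[OF assms(1,2)]
  note vf = N.chart_dom_open[OF d] F_coord_smooth[OF d]
  let ?y = "\<lambda>i q. vec_in B ?d (f q) (Y q) \<bullet> i" and ?E = "\<lambda>i r. coord_vec B ?d r i"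
  have y: "smooth_fun_on A ?W (?y i)" for i by (rule smooth_component[OF assms(1,3) d])
  have FE: "smooth_along ?W (\<lambda>q. F (f q) (?E i (f q)))" for i
    by (rule smooth_along_subset[OF smooth_along_pullback[OF vf]]) simp
  have "cov p u (\<lambda>q. F (f q) (Y q)) = cov p u (\<lambda>q. \<Sum>i\<in>Basis. ?y i q *\<^sub>R F (f q) (?E i (f q)))"
    by (rule cov_cong[OF W]) (rule F_expansion[OF d], simp)
  also have "\<dots> = (\<Sum>i\<in>Basis. dfun A (?y i) p u *\<^sub>R F (f p) (?E i (f p)) +
      ?y i p *\<^sub>R cov p u (\<lambda>q. F (f q) (?E i (f q))))"
    by (simp add: cov_sum[OF W smooth_along_scaleR[OF W(1) y FE]] cov_scaleR[OF W y FE])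
  also have "\<dots> = (\<Sum>i\<in>Basis. dfun A (?y i) p u *\<^sub>R F (f p) (?E i (f p)) +
      ?y i p *\<^sub>R F (f p) (nab (f p) (df p u) (?E i)))"
    by (simp add: cov_pullback[OF vf(1) fp vf(2)] F_parallel_coord[OF d fp])
  finally show ?thesis
    by (simp add: cov_eq linear_sum[OF F_linear] linear_add[OF F_linear] linear_cmul[OF F_linear])
qed

text \<open>On the left, the normal parts of the derivatives of \<open>C \<xi>\<close> and of \<open>df (B \<xi>)\<close> add up to that of the
  derivative of \<open>F \<xi>\<close>. Moving \<open>F\<close> out of the derivative leaves the normal part of \<open>F\<close> applied to
  \<open>D \<xi>\<close>; the contribution of the normal part of \<open>D \<xi>\<close> to this is exactly what \<open>cov_deriv_C\<close>
  subtracts.\<close>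

lemma cov_deriv_C_eq:
  assumes \<xi>: "smooth_along UNIV \<xi>"
  shows "cov_deriv_C A B g nab F f X \<xi> p + sff X (Bop A B g F f \<xi>) p =
    norp p (F (f p) (df p (tanp p (cov p (X p) \<xi>))))"
proof -
  note F\<xi> = smooth_along_F[OF open_UNIV \<xi>]
  have C: "smooth_along UNIV (\<lambda>q. norp q (F (f q) (\<xi> q)))"
    by (rule smooth_nor_part[OF open_UNIV F\<xi>])
  have BB: "smooth_along UNIV (\<lambda>q. df q (tanp q (F (f q) (\<xi> q))))"
    by (rule smooth_along_dmap[OF open_UNIV smooth_tan_part[OF open_UNIV F\<xi>]])
  have "normal_conn A B g nab f X (Cop A B g F f \<xi>) p + sff X (Bop A B g F f \<xi>) p =
      norp p (cov p (X p) (\<lambda>q. df q (tanp q (F (f q) (\<xi> q)))) + cov p (X p) (\<lambda>q. norp q (F (f q) (\<xi> q))))"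
    unfolding normal_conn_def second_ff_def Cop_def[abs_def] Bop_def[abs_def]
    by (simp add: linear_add[OF nor_part_linear])
  also have "\<dots> = norp p (cov p (X p) (\<lambda>q. df q (tanp q (F (f q) (\<xi> q))) + norp q (F (f q) (\<xi> q))))"
    by (simp add: cov_add[OF open_UNIV UNIV_I BB C])
  also have "\<dots> = norp p (F (f p) (cov p (X p) \<xi>))"
    by (simp add: tan_nor_decomposition[symmetric] cov_F[OF open_UNIV UNIV_I \<xi>])
  also have "\<dots> = norp p (F (f p) (df p (tanp p (cov p (X p) \<xi>)))) + norp p (F (f p) (norp p (cov p (X p) \<xi>)))"
    by (simp flip: linear_add[OF nor_part_linear] linear_add[OF F_linear] tan_nor_decomposition)
  finally show ?thesis
    by (simp add: cov_deriv_C_def normal_conn_def Cop_def algebra_simps)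
qed

text \<open>In classical terms \<open>A\<^sub>H u = g(H, H) u\<close>: differentiate \<open>g(H, df V) = 0\<close> along \<open>u\<close>. Both \<open>u\<close> and \<open>v\<close> are
  extended to global fields because pseudo-umbilicity is a statement about these.\<close>

lemma tan_cov_mean_curvature:
  assumes pu: "pseudo_umbilical A gM B g nab f"
  shows "tanp p (cov p u mean) = - g (f p) (mean p) (mean p) *\<^sub>R u"
proof (rule gM_eqI)
  fix v
  obtain X V where X: "vector_field A X" "X p = u" and V: "vector_field A V" "V p = v"
    using M.ex_vector_field by metis
  note dV = smooth_along_dmap[OF open_UNIV V(1)]
  have "0 = dfun A (\<lambda>q. g (f q) (mean q) (df q (V q))) p u"
    by (simp add: mean_curvature_normal M.dfun_const)
  also have "\<dots> = g (f p) (cov p u mean) (df p v) + g (f p) (mean p) (cov p u (\<lambda>q. df q (V q)))"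
    by (simp add: cov_metric[OF open_UNIV UNIV_I smooth_mean_curvature dV] V(2))
  also have "g (f p) (mean p) (cov p u (\<lambda>q. df q (V q))) = g (f p) (sff X V p) (mean p)"
    unfolding second_ff_def X(2) g_nor_part[OF mean_curvature_normal] by (rule g_sym)
  also have "\<dots> = gM p u v * g (f p) (mean p) (mean p)"
    using pu[unfolded pseudo_umbilical_def Let_def, rule_format, OF X(1) V(1), of p]
    by (simp add: X(2) V(2))
  finally show "gM p (tanp p (cov p u mean)) v = gM p (- g (f p) (mean p) (mean p) *\<^sub>R u) v"
    by (simp add: gM_tan_part gM_simps bilinear_lneg[OF gM_bilinear] mult.commute eq_neg_iff_add_eq_0)
qed

lemma pseudo_umbilical_cov_deriv_C:
  assumes "pseudo_umbilical A gM B g nab f"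
  shows "cov_deriv_C A B g nab F f X mean p + sff X (Bop A B g F f mean) p =
    - g (f p) (mean p) (mean p) *\<^sub>R omega A B g F f X p"
  by (simp add: cov_deriv_C_eq[OF smooth_mean_curvature] tan_cov_mean_curvature[OF assms] omega_def
      linear_cmul[OF dmap_linear] linear_cmul[OF F_linear] linear_cmul[OF nor_part_linear]
      linear_neg[OF dmap_linear] linear_neg[OF F_linear] linear_neg[OF nor_part_linear])

text \<open>Decompose \<open>X p\<close> into \<open>v\<close> in \<open>D\<close> and \<open>w\<close> in \<open>D'\<close>. As \<open>F w\<close> is normal, \<open>\<phi> X\<close> is \<open>F v\<close>, a vector of \<open>D\<close>;
  then \<open>F\<close> maps it into \<open>D\<close> again, without normal component.\<close>

lemma semi_invariant_omega_phi:
  assumes "semi_invariant A B g F f"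
  shows "omega A B g F f (phi A B g F f X) p = 0"
proof -
  obtain D D' where D: "\<forall>u. \<exists>v\<in>D p. \<exists>w\<in>D' p. u = v + w"
    "F (f p) ` (df p ` D p) = df p ` D p" "F (f p) ` (df p ` D' p) \<subseteq> normal_space A B g f p"
    using assms unfolding semi_invariant_def by metis
  obtain v w where vw: "v \<in> D p" "w \<in> D' p" "X p = v + w" using D(1) by metis
  obtain v' where v': "v' \<in> D p" "F (f p) (df p v) = df p v'" using D(2) vw(1) by blast
  obtain v'' where v'': "F (f p) (df p v') = df p v''" using D(2) v'(1) by blast
  have "F (f p) (df p w) \<in> normal_space A B g f p" using D(3) vw(2) by blast
  then have "tanp p (F (f p) (df p w)) = 0"
    by (intro tan_part_eqI) (simp add: normal_space_def gM_simps)
  then have "phi A B g F f X p = v'"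
    by (simp add: phi_def vw(3) linear_add[OF dmap_linear] linear_add[OF F_linear]
        linear_add[OF tan_part_linear] v'(2) tan_part_df)
  then show ?thesis by (simp add: omega_def v'' nor_part_df)
qed

end

section \<open>The equivalence\<close>

theorem theorem7:
  fixes A :: "('m::{t2_space, second_countable_topology}, 'a::euclidean_space) atlas"
    and gM :: "'m \<Rightarrow> 'a \<Rightarrow> 'a \<Rightarrow> real"
    and B :: "('n::{t2_space, second_countable_topology}, 'b::euclidean_space) atlas"
    and g :: "'n \<Rightarrow> 'b \<Rightarrow> 'b \<Rightarrow> real"
    and nab :: "('n, 'b) connection"
    and F :: "'n \<Rightarrow> 'b \<Rightarrow> 'b"
    and f :: "'m \<Rightarrow> 'n"
    and H :: "'m \<Rightarrow> 'b"
  assumes "locally_product B g nab F"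
    and "riemannian_manifold A gM"
    and "isometric_immersion A gM B g f"
    and "pseudo_umbilical A gM B g nab f"
    and "H = mean_curvature A gM B g nab f"
  shows "(\<forall>X. vector_field A X \<longrightarrow>
            (\<forall>p. g (f p) (cov_deriv_C A B g nab F f (phi A B g F f X) H p) (Cop A B g F f H p) =
               - g (f p) (second_ff A B g nab f (phi A B g F f X) (Bop A B g F f H) p)
                         (Cop A B g F f H p)))
     \<longleftrightarrow>
         (minimal_submanifold A gM B g nab f \<or>
          semi_invariant A B g F f \<or>
          (\<forall>X. vector_field A X \<longrightarrow>
             (\<forall>p. g (f p) (omega A B g F f (phi A B g F f X) p) (Cop A B g F f H p) = 0)))"
proof -
  interpret product_immersion A B f nab g gM F
    using assms(1-3)
    by unfold_locales
       (auto simp: locally_product_def riemannian_manifold_def levi_civita_def isometric_immersion_def)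
  let ?\<phi> = "phi A B g F f" and ?C = "Cop A B g F f H"
  \<comment> \<open>At zeros of \<open>H\<close> the factor \<open>g(H, H)\<close> carries no information, but there \<open>C H\<close> vanishes as well.\<close>
  have C0: "?C p = 0" if "H p = 0" for p
    using that by (simp add: Cop_def linear_0[OF F_linear] linear_0[OF nor_part_linear])
  have identity: "g (f p) (cov_deriv_C A B g nab F f (?\<phi> X) H p) (?C p) =
        - g (f p) (sff (?\<phi> X) (Bop A B g F f H) p) (?C p)
      \<longleftrightarrow> g (f p) (omega A B g F f (?\<phi> X) p) (?C p) = 0" for X p
  proof -
    have "g (f p) (cov_deriv_C A B g nab F f (?\<phi> X) H p) (?C p) + g (f p) (sff (?\<phi> X) (Bop A B g F f H) p) (?C p)
      = g (f p) (- g (f p) (H p) (H p) *\<^sub>R omega A B g F f (?\<phi> X) p) (?C p)"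
      unfolding assms(5) pseudo_umbilical_cov_deriv_C[OF assms(4), symmetric] by (simp add: g_simps)
    also have "\<dots> = - (g (f p) (H p) (H p) * g (f p) (omega A B g F f (?\<phi> X) p) (?C p))"
      by (simp add: g_simps)
    finally have "g (f p) (cov_deriv_C A B g nab F f (?\<phi> X) H p) (?C p) =
        - g (f p) (sff (?\<phi> X) (Bop A B g F f H) p) (?C p)
      \<longleftrightarrow> H p = 0 \<or> g (f p) (omega A B g F f (?\<phi> X) p) (?C p) = 0"
      using g_eq_0_iff[of "f p" "H p"] by (auto simp: add_eq_0_iff2)
    then show ?thesis using C0[of p] by (auto simp: g_simps)
  qed
  have "g (f p) (omega A B g F f (?\<phi> X) p) (?C p) = 0" if "minimal_submanifold A gM B g nab f" for X p
    using that C0[of p] by (simp add: minimal_submanifold_def assms(5) g_simps)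
  moreover have "g (f p) (omega A B g F f (?\<phi> X) p) (?C p) = 0" if "semi_invariant A B g F f" for X p
    by (simp add: semi_invariant_omega_phi[OF that] g_simps)
  ultimately show ?thesis unfolding identity by blast
qed

end
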